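(* Let $L$ be a Dirac structure in a Courant algebroid $(A,\circ,\rho,\langle\cdot,\cdot\rangle)$. (a) If a paired $(1,1)$-tensor $N$ on $A$ is an outer Nijenhuis tensor for $L$, then $(L,N)$ is a Dirac-Nijenhuis structure. (b) If $(L,N)$ is a Dirac-Nijenhuis structure, then $L$ is a Lie algebroid with respect to the product $\circ_N$, and $N(X\circ_NY)=NX\circ NY$ for all $X,Y\in Sec(L)$.
   Context: A Leibniz product on a vector space is a bilinear operation $\circ$ with $(X\circ Y)\circ Z=X\circ(Y\circ Z)-Y\circ(X\circ Z)$. A Courant algebroid is a vector bundle $A\to M$ with a Leibniz product $\circ$ on $Sec(A)$, a vector bundle map $\rho:A\to TM$ over the identity, and a nondegenerate symmetric bilinear form $\langle\cdot,\cdot\rangle$ on $A$ such that $\rho(X)\langle Y,Y\rangle=2\langle X,Y\circ Y\rangle$ and $\rho(X)\langle Y,Y\rangle=2\langle X\circ Y,Y\rangle$ for all sections $X,Y$. A Dirac structure in $A$ is a subbundle $L\subset A$ which is maximal isotropic for $\langle\cdot,\cdot\rangle$ and whose sections are closed under $\circ$. A $(1,1)$-tensor on $A$ is a vector bundle morphism $N:A\to A$ over the identity; its contracted (deformed) product is $X\circ_NY=N(X)\circ Y+X\circ N(Y)-N(X\circ Y)$ and its Nijenhuis torsion is $T_N(X,Y)=N(X)\circ N(Y)-N(X\circ_NY)$. $N$ is paired if $N+N^*=\lambda I$ for some $\lambda\in\mathbb{R}$, where $N^*$ is the adjoint of $N$ with respect to $\langle\cdot,\cdot\rangle$. $N$ is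 an outer Nijenhuis tensor for a subbundle $L$ (with $Sec(L)$ closed under $\circ$) if $Sec(L)$ is also closed under $\circ_N$ and $T_N(X,Y)=0$ for all $X,Y\in Sec(L)$. $(L,N)$ is a Dirac-Nijenhuis structure if $N$ is a $(1,1)$-tensor on $A$ such that $Sec(L)$ is closed under $\circ_N$, $\circ_N$ is skew-symmetric on $Sec(L)$, and $T_N(X,Y)=0$ for all $X,Y\in Sec(L)$. *)

theory Defs
  imports "HOL-Analysis.Analysis"
begin

section \<open>Model spaces\<close>

text \<open>
  Manifolds and vector bundles are modelled on finite-dimensional inner product spaces. The class
  \<open>euclidean_space\<close> is not used because it excludes dimension 0, and both zero-dimensional
  bases (quadratic Lie algebras as Courant algebroids over a point) and zero Dirac structures
  (definite metrics) are legitimate.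
\<close>

class finite_dim_inner = real_inner +
  assumes finite_spanning: "\<exists>B. finite B \<and> (\<forall>x. \<exists>r. x = (\<Sum>b\<in>B. scaleR (r b) b))"

instance euclidean_space \<subseteq> finite_dim_inner
proof
  show "\<exists>B::'a set. finite B \<and> (\<forall>x. \<exists>r. x = (\<Sum>b\<in>B. scaleR (r b) b))"
    by (metis euclidean_representation finite_Basis)
qed

text \<open>Only meant for open sets \<open>S\<close> in finite-dimensional spaces.\<close>

primrec Ck_on :: "nat \<Rightarrow> 'a::real_normed_vector set \<Rightarrow> ('a \<Rightarrow> 'b::real_normed_vector) \<Rightarrow> bool" where
  "Ck_on 0 S f \<longleftrightarrow> continuous_on S f"
| "Ck_on (Suc k) S f \<longleftrightarrow>
     (\<forall>x\<in>S. f differentiable (at x)) \<and> (\<forall>v. Ck_on k S (\<lambda>x. frechet_derivative f (at x) v))"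

definition smooth_on :: "'a::real_normed_vector set \<Rightarrow> ('a \<Rightarrow> 'b::real_normed_vector) \<Rightarrow> bool" where
  "smooth_on S f \<longleftrightarrow> (\<forall>k. Ck_on k S f)"


section \<open>Smooth manifolds\<close>

text \<open>
  The manifold is the whole type \<open>'m\<close>, Hausdorff and second countable by its type class. A chart is
  its domain together with the coordinate map; its values outside the domain are irrelevant.
\<close>

type_synonym ('m, 'e) chart = "'m set \<times> ('m \<Rightarrow> 'e)"

definition chart_inv :: "('m, 'e) chart \<Rightarrow> 'e \<Rightarrow> 'm" where
  "chart_inv c = inv_into (fst c) (snd c)"

locale smooth_manifold =
  fixes \<A> :: "('m::{t2_space,second_countable_topology}, 'e::finite_dim_inner) chart set"
  assumes charts: "c \<in> \<A> \<Longrightarrow>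
      open (fst c) \<and> open (snd c ` fst c) \<and> homeomorphism (fst c) (snd c ` fst c) (snd c) (chart_inv c)"
    and cover: "(\<Union>c\<in>\<A>. fst c) = UNIV"
    and compatible: "c \<in> \<A> \<Longrightarrow> d \<in> \<A> \<Longrightarrow> smooth_on (snd c ` (fst c \<inter> fst d)) (snd d \<circ> chart_inv c)"

definition smooth_map_on ::
  "('m, 'e::real_normed_vector) chart set \<Rightarrow> 'm set \<Rightarrow> ('m \<Rightarrow> 'b::real_normed_vector) \<Rightarrow> bool" where
  "smooth_map_on \<A> U f \<longleftrightarrow> (\<forall>c\<in>\<A>. smooth_on (snd c ` (fst c \<inter> U)) (f \<circ> chart_inv c))"


section \<open>Vector bundles\<close>

text \<open>
  The total space is the disjoint union of the fibres, which are subspaces of one real vector space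
  \<open>'a\<close>. This is no restriction: the fibres of any bundle embed in the direct sum of all fibres.
  The space \<open>'a\<close> carries no topology; the smooth structure is given by the local trivialisations
  \<open>(U, \<phi>)\<close>, where \<open>\<phi> p\<close> identifies the fibre over \<open>p \<in> U\<close> with the typical fibre \<open>'f\<close>.
\<close>

record ('m, 'a, 'f) vbundle =
  fibre :: "'m \<Rightarrow> 'a set"
  trivs :: "('m set \<times> ('m \<Rightarrow> 'a \<Rightarrow> 'f)) set"

definition triv_inv ::
  "('m, 'a, 'f) vbundle \<Rightarrow> 'm set \<times> ('m \<Rightarrow> 'a \<Rightarrow> 'f) \<Rightarrow> 'm \<Rightarrow> 'f \<Rightarrow> 'a" where
  "triv_inv E t p = inv_into (fibre E p) (snd t p)"

definition linear_on :: "'a::real_vector set \<Rightarrow> ('a \<Rightarrow> 'b::real_vector) \<Rightarrow> bool" where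
  "linear_on S f \<longleftrightarrow>
     (\<forall>x\<in>S. \<forall>y\<in>S. f (x + y) = f x + f y) \<and> (\<forall>r. \<forall>x\<in>S. f (r *\<^sub>R x) = r *\<^sub>R f x)"

text \<open>
  Smoothness of a map of total spaces over the identity of \<open>'m\<close>, in the bundle coordinates
  \<open>(x, w)\<close> consisting of a base coordinate and a vector of the typical fibre.
\<close>

definition smooth_over ::
  "('m, 'e::real_normed_vector) chart set \<Rightarrow> ('m, 'a, 'f::real_normed_vector) vbundle \<Rightarrow>
   ('m, 'b, 'g::real_normed_vector) vbundle \<Rightarrow> ('m \<Rightarrow> 'a \<Rightarrow> 'b) \<Rightarrow> bool" where
  "smooth_over \<A> E F \<Phi> \<longleftrightarrow> (\<forall>c\<in>\<A>. \<forall>s\<in>trivs E. \<forall>t\<in>trivs F.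
     smooth_on ((snd c ` (fst c \<inter> fst s \<inter> fst t)) \<times> UNIV)
       (\<lambda>(x, w). let p = chart_inv c x in snd t p (\<Phi> p (triv_inv E s p w))))"

locale vector_bundle = smooth_manifold \<A>
  for \<A> :: "('m::{t2_space,second_countable_topology}, 'e::finite_dim_inner) chart set" +
  fixes E :: "('m, 'a::real_vector, 'f::finite_dim_inner) vbundle"
  assumes subspace_fibre: "subspace (fibre E p)"
    and triv_open: "t \<in> trivs E \<Longrightarrow> open (fst t)"
    and triv_iso: "t \<in> trivs E \<Longrightarrow> p \<in> fst t \<Longrightarrow>
      linear_on (fibre E p) (snd t p) \<and> bij_betw (snd t p) (fibre E p) UNIV"
    and triv_cover: "(\<Union>t\<in>trivs E. fst t) = UNIV"
    and smooth_transitions: "smooth_over \<A> E E (\<lambda>p v. v)"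

definition bundle_map ::
  "('m, 'e::real_normed_vector) chart set \<Rightarrow> ('m, 'a::real_vector, 'f::real_normed_vector) vbundle \<Rightarrow>
   ('m, 'b::real_vector, 'g::real_normed_vector) vbundle \<Rightarrow> ('m \<Rightarrow> 'a \<Rightarrow> 'b) \<Rightarrow> bool" where
  "bundle_map \<A> E F \<Phi> \<longleftrightarrow>
     (\<forall>p. \<Phi> p ` fibre E p \<subseteq> fibre F p \<and> linear_on (fibre E p) (\<Phi> p)) \<and> smooth_over \<A> E F \<Phi>"

definition Sec ::
  "('m, 'e::real_normed_vector) chart set \<Rightarrow> ('m, 'a, 'f::real_normed_vector) vbundle \<Rightarrow> ('m \<Rightarrow> 'a) set" where
  "Sec \<A> E = {X. (\<forall>p. X p \<in> fibre E p) \<and>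
     (\<forall>t\<in>trivs E. smooth_map_on \<A> (fst t) (\<lambda>p. snd t p (X p)))}"

text \<open>A subbundle has its own bundle structure, for which the inclusion is a bundle map.\<close>

definition subbundle ::
  "('m::{t2_space,second_countable_topology}, 'e::finite_dim_inner) chart set \<Rightarrow>
   ('m, 'a::real_vector, 'l::finite_dim_inner) vbundle \<Rightarrow>
   ('m, 'a, 'f::finite_dim_inner) vbundle \<Rightarrow> bool" where
  "subbundle \<A> L E \<longleftrightarrow>
     vector_bundle \<A> L \<and> (\<forall>p. fibre L p \<subseteq> fibre E p) \<and> bundle_map \<A> L E (\<lambda>p v. v)"

text \<open>
  A tangent vector at \<open>p\<close> is its coordinate vector in a fixed preferred chart around \<open>p\<close>; the
  coordinates in any other chart are obtained by the derivative of the transition map.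
\<close>

definition pref_chart :: "('m, 'e) chart set \<Rightarrow> 'm \<Rightarrow> ('m, 'e) chart" where
  "pref_chart \<A> p = (SOME c. c \<in> \<A> \<and> p \<in> fst c)"

definition tangent_map ::
  "('m, 'e::real_normed_vector) chart set \<Rightarrow> ('m \<Rightarrow> 'b::real_normed_vector) \<Rightarrow> 'm \<Rightarrow> 'e \<Rightarrow> 'b" where
  "tangent_map \<A> f p v =
     frechet_derivative (f \<circ> chart_inv (pref_chart \<A> p)) (at (snd (pref_chart \<A> p) p)) v"

definition tangent_bundle ::
  "('m, 'e::real_normed_vector) chart set \<Rightarrow> ('m, 'e, 'e) vbundle" where
  "tangent_bundle \<A> = \<lparr>fibre = (\<lambda>p. UNIV), trivs = (\<lambda>c. (fst c, tangent_map \<A> (snd c))) ` \<A>\<rparr>"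

definition deriv_along ::
  "('m, 'e::real_normed_vector) chart set \<Rightarrow> ('m \<Rightarrow> 'e) \<Rightarrow> ('m \<Rightarrow> real) \<Rightarrow> 'm \<Rightarrow> real" where
  "deriv_along \<A> V f p = tangent_map \<A> f p (V p)"

text \<open>Nondegenerate symmetric bilinear forms, smooth as functions on the fibred square of the bundle.\<close>

definition bundle_metric ::
  "('m, 'e::real_normed_vector) chart set \<Rightarrow> ('m, 'a::real_vector, 'f::real_normed_vector) vbundle \<Rightarrow>
   ('m \<Rightarrow> 'a \<Rightarrow> 'a \<Rightarrow> real) \<Rightarrow> bool" where
  "bundle_metric \<A> E g \<longleftrightarrow>
     (\<forall>p. \<forall>u\<in>fibre E p. linear_on (fibre E p) (g p u)) \<and>
     (\<forall>p. \<forall>u\<in>fibre E p. \<forall>v\<in>fibre E p. g p u v = g p v u) \<and>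
     (\<forall>p. \<forall>u\<in>fibre E p. (\<forall>v\<in>fibre E p. g p u v = 0) \<longrightarrow> u = 0) \<and>
     (\<forall>c\<in>\<A>. \<forall>t\<in>trivs E. smooth_on ((snd c ` (fst c \<inter> fst t)) \<times> UNIV)
        (\<lambda>(x, w, z). let p = chart_inv c x in g p (triv_inv E t p w) (triv_inv E t p z)))"


section \<open>Courant and Lie algebroids\<close>

definition closed_under :: "'s set \<Rightarrow> ('s \<Rightarrow> 's \<Rightarrow> 's) \<Rightarrow> bool" where
  "closed_under S m \<longleftrightarrow> (\<forall>X\<in>S. \<forall>Y\<in>S. m X Y \<in> S)"

text \<open>Bilinearity is over the reals, with pointwise vector space operations on sections.\<close>

definition bilinear_product ::
  "('m \<Rightarrow> 'a::real_vector) set \<Rightarrow> (('m \<Rightarrow> 'a) \<Rightarrow> ('m \<Rightarrow> 'a) \<Rightarrow> 'm \<Rightarrow> 'a) \<Rightarrow> bool" where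
  "bilinear_product S m \<longleftrightarrow> closed_under S m \<and>
     (\<forall>X\<in>S. \<forall>Y\<in>S. \<forall>Z\<in>S.
        m (\<lambda>p. X p + Y p) Z = (\<lambda>p. m X Z p + m Y Z p) \<and>
        m Z (\<lambda>p. X p + Y p) = (\<lambda>p. m Z X p + m Z Y p)) \<and>
     (\<forall>X\<in>S. \<forall>Y\<in>S. \<forall>r.
        m (\<lambda>p. r *\<^sub>R X p) Y = (\<lambda>p. r *\<^sub>R m X Y p) \<and>
        m X (\<lambda>p. r *\<^sub>R Y p) = (\<lambda>p. r *\<^sub>R m X Y p))"

definition leibniz_product ::
  "('m \<Rightarrow> 'a::real_vector) set \<Rightarrow> (('m \<Rightarrow> 'a) \<Rightarrow> ('m \<Rightarrow> 'a) \<Rightarrow> 'm \<Rightarrow> 'a) \<Rightarrow> bool" where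
  "leibniz_product S m \<longleftrightarrow> bilinear_product S m \<and>
     (\<forall>X\<in>S. \<forall>Y\<in>S. \<forall>Z\<in>S. m (m X Y) Z = (\<lambda>p. m X (m Y Z) p - m Y (m X Z) p))"

definition skew_product ::
  "('m \<Rightarrow> 'a::real_vector) set \<Rightarrow> (('m \<Rightarrow> 'a) \<Rightarrow> ('m \<Rightarrow> 'a) \<Rightarrow> 'm \<Rightarrow> 'a) \<Rightarrow> bool" where
  "skew_product S m \<longleftrightarrow> (\<forall>X\<in>S. \<forall>Y\<in>S. m X Y = (\<lambda>p. - m Y X p))"

locale courant_algebroid = vector_bundle \<A> A
  for \<A> :: "('m::{t2_space,second_countable_topology}, 'e::finite_dim_inner) chart set"
    and A :: "('m, 'a::real_vector, 'f::finite_dim_inner) vbundle" +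
  fixes circ :: "('m \<Rightarrow> 'a) \<Rightarrow> ('m \<Rightarrow> 'a) \<Rightarrow> 'm \<Rightarrow> 'a"
    and \<rho> :: "'m \<Rightarrow> 'a \<Rightarrow> 'e"
    and g :: "'m \<Rightarrow> 'a \<Rightarrow> 'a \<Rightarrow> real"
  assumes leibniz: "leibniz_product (Sec \<A> A) circ"
    and anchor: "bundle_map \<A> A (tangent_bundle \<A>) \<rho>"
    and metric: "bundle_metric \<A> A g"
    and compat_right: "X \<in> Sec \<A> A \<Longrightarrow> Y \<in> Sec \<A> A \<Longrightarrow>
      deriv_along \<A> (\<lambda>p. \<rho> p (X p)) (\<lambda>p. g p (Y p) (Y p)) = (\<lambda>p. 2 * g p (X p) (circ Y Y p))"
    and compat_left: "X \<in> Sec \<A> A \<Longrightarrow> Y \<in> Sec \<A> A \<Longrightarrow>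
      deriv_along \<A> (\<lambda>p. \<rho> p (X p)) (\<lambda>p. g p (Y p) (Y p)) = (\<lambda>p. 2 * g p (circ X Y p) (Y p))"

locale lie_algebroid = vector_bundle \<A> L
  for \<A> :: "('m::{t2_space,second_countable_topology}, 'e::finite_dim_inner) chart set"
    and L :: "('m, 'a::real_vector, 'l::finite_dim_inner) vbundle" +
  fixes br :: "('m \<Rightarrow> 'a) \<Rightarrow> ('m \<Rightarrow> 'a) \<Rightarrow> 'm \<Rightarrow> 'a"
    and \<rho> :: "'m \<Rightarrow> 'a \<Rightarrow> 'e"
  assumes bilinear: "bilinear_product (Sec \<A> L) br"
    and skew: "skew_product (Sec \<A> L) br"
    and jacobi: "X \<in> Sec \<A> L \<Longrightarrow> Y \<in> Sec \<A> L \<Longrightarrow> Z \<in> Sec \<A> L \<Longrightarrow>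
      br X (br Y Z) p + br Y (br Z X) p + br Z (br X Y) p = 0"
    and anchor: "bundle_map \<A> L (tangent_bundle \<A>) \<rho>"
    and leibniz_rule: "X \<in> Sec \<A> L \<Longrightarrow> Y \<in> Sec \<A> L \<Longrightarrow> smooth_map_on \<A> UNIV f \<Longrightarrow>
      br X (\<lambda>p. f p *\<^sub>R Y p) =
        (\<lambda>p. f p *\<^sub>R br X Y p + deriv_along \<A> (\<lambda>p. \<rho> p (X p)) f p *\<^sub>R Y p)"

definition isotropic :: "('a \<Rightarrow> 'a \<Rightarrow> real) \<Rightarrow> 'a set \<Rightarrow> bool" where
  "isotropic b S \<longleftrightarrow> (\<forall>u\<in>S. \<forall>v\<in>S. b u v = 0)"

definition maximal_isotropic :: "('a::real_vector \<Rightarrow> 'a \<Rightarrow> real) \<Rightarrow> 'a set \<Rightarrow> 'a set \<Rightarrow> bool" where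
  "maximal_isotropic b V S \<longleftrightarrow> subspace S \<and> S \<subseteq> V \<and> isotropic b S \<and>
     (\<forall>T. subspace T \<and> T \<subseteq> V \<and> isotropic b T \<and> S \<subseteq> T \<longrightarrow> T = S)"

definition dirac_structure ::
  "('m::{t2_space,second_countable_topology}, 'e::finite_dim_inner) chart set \<Rightarrow>
   ('m, 'a::real_vector, 'f::finite_dim_inner) vbundle \<Rightarrow>
   (('m \<Rightarrow> 'a) \<Rightarrow> ('m \<Rightarrow> 'a) \<Rightarrow> 'm \<Rightarrow> 'a) \<Rightarrow> ('m \<Rightarrow> 'a \<Rightarrow> 'a \<Rightarrow> real) \<Rightarrow>
   ('m, 'a, 'l::finite_dim_inner) vbundle \<Rightarrow> bool" where
  "dirac_structure \<A> A circ g L \<longleftrightarrow>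
     subbundle \<A> L A \<and> (\<forall>p. maximal_isotropic (g p) (fibre A p) (fibre L p)) \<and>
     closed_under (Sec \<A> L) circ"


section \<open>Nijenhuis tensors\<close>

definition app :: "('m \<Rightarrow> 'a \<Rightarrow> 'b) \<Rightarrow> ('m \<Rightarrow> 'a) \<Rightarrow> 'm \<Rightarrow> 'b" where
  "app N X = (\<lambda>p. N p (X p))"

definition contracted ::
  "(('m \<Rightarrow> 'a::real_vector) \<Rightarrow> ('m \<Rightarrow> 'a) \<Rightarrow> 'm \<Rightarrow> 'a) \<Rightarrow> ('m \<Rightarrow> 'a \<Rightarrow> 'a) \<Rightarrow>
   ('m \<Rightarrow> 'a) \<Rightarrow> ('m \<Rightarrow> 'a) \<Rightarrow> 'm \<Rightarrow> 'a" where
  "contracted circ N X Y =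
     (\<lambda>p. circ (app N X) Y p + circ X (app N Y) p - app N (circ X Y) p)"

definition torsion ::
  "(('m \<Rightarrow> 'a::real_vector) \<Rightarrow> ('m \<Rightarrow> 'a) \<Rightarrow> 'm \<Rightarrow> 'a) \<Rightarrow> ('m \<Rightarrow> 'a \<Rightarrow> 'a) \<Rightarrow>
   ('m \<Rightarrow> 'a) \<Rightarrow> ('m \<Rightarrow> 'a) \<Rightarrow> 'm \<Rightarrow> 'a" where
  "torsion circ N X Y =
     (\<lambda>p. circ (app N X) (app N Y) p - app N (contracted circ N X Y) p)"

definition is_adjoint ::
  "('m, 'a, 'f) vbundle \<Rightarrow> ('m \<Rightarrow> 'a \<Rightarrow> 'a \<Rightarrow> real) \<Rightarrow>
   ('m \<Rightarrow> 'a \<Rightarrow> 'a) \<Rightarrow> ('m \<Rightarrow> 'a \<Rightarrow> 'a) \<Rightarrow> bool" where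
  "is_adjoint A g N N' \<longleftrightarrow> (\<forall>p. \<forall>u\<in>fibre A p. \<forall>v\<in>fibre A p.
     N' p v \<in> fibre A p \<and> g p (N p u) v = g p u (N' p v))"

definition paired ::
  "('m, 'a::real_vector, 'f) vbundle \<Rightarrow> ('m \<Rightarrow> 'a \<Rightarrow> 'a \<Rightarrow> real) \<Rightarrow> ('m \<Rightarrow> 'a \<Rightarrow> 'a) \<Rightarrow> bool" where
  "paired A g N \<longleftrightarrow> (\<exists>N' (l::real). is_adjoint A g N N' \<and>
     (\<forall>p. \<forall>v\<in>fibre A p. N p v + N' p v = l *\<^sub>R v))"

definition outer_nijenhuis ::
  "('m, 'e::real_normed_vector) chart set \<Rightarrow> ('m, 'a::real_vector, 'l::real_normed_vector) vbundle \<Rightarrow>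
   (('m \<Rightarrow> 'a) \<Rightarrow> ('m \<Rightarrow> 'a) \<Rightarrow> 'm \<Rightarrow> 'a) \<Rightarrow> ('m \<Rightarrow> 'a \<Rightarrow> 'a) \<Rightarrow> bool" where
  "outer_nijenhuis \<A> L circ N \<longleftrightarrow>
     closed_under (Sec \<A> L) circ \<and> closed_under (Sec \<A> L) (contracted circ N) \<and>
     (\<forall>X\<in>Sec \<A> L. \<forall>Y\<in>Sec \<A> L. torsion circ N X Y = (\<lambda>p. 0))"

definition dirac_nijenhuis ::
  "('m::{t2_space,second_countable_topology}, 'e::finite_dim_inner) chart set \<Rightarrow>
   ('m, 'a::real_vector, 'f::finite_dim_inner) vbundle \<Rightarrow>
   (('m \<Rightarrow> 'a) \<Rightarrow> ('m \<Rightarrow> 'a) \<Rightarrow> 'm \<Rightarrow> 'a) \<Rightarrow> ('m \<Rightarrow> 'a \<Rightarrow> 'a \<Rightarrow> real) \<Rightarrow>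
   ('m, 'a, 'l::finite_dim_inner) vbundle \<Rightarrow> ('m \<Rightarrow> 'a \<Rightarrow> 'a) \<Rightarrow> bool" where
  "dirac_nijenhuis \<A> A circ g L N \<longleftrightarrow>
     dirac_structure \<A> A circ g L \<and> bundle_map \<A> A A N \<and>
     closed_under (Sec \<A> L) (contracted circ N) \<and>
     skew_product (Sec \<A> L) (contracted circ N) \<and>
     (\<forall>X\<in>Sec \<A> L. \<forall>Y\<in>Sec \<A> L. torsion circ N X Y = (\<lambda>p. 0))"

end

theory Submission
  imports Defs
begin

text \<open>
  Part (a) asks for the skew-symmetry of the contracted product \<open>\<circ>\<^sub>N\<close> on sections of \<open>L\<close>, and by
  polarisation it is enough that \<open>X \<circ>\<^sub>N X = N X \<circ> X + X \<circ> N X - N(X \<circ> X)\<close> vanishes. The polarised axiom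
  \<open>\<rho>(Z)\<langle>X, Y\<rangle> = \<langle>Z, X \<circ> Y + Y \<circ> X\<rangle>\<close> says that symmetric parts of the product are governed by the metric:
  \<open>X \<circ> X = 0\<close> since \<open>\<langle>X, X\<rangle> = 0\<close> on \<open>L\<close>, and \<open>N X \<circ> X + X \<circ> N X = 0\<close> since \<open>\<langle>N X, X\<rangle> = 0\<close>. The latter
  holds because \<open>N + N\<^sup>* = \<lambda> I\<close> gives \<open>2 \<langle>N X, X\<rangle> = \<lambda> \<langle>X, X\<rangle> = 0\<close>. This is the content of
  \<open>paired_isotropic\<close>, \<open>contracted_self_eq_0\<close> and \<open>contracted_skew_on_dirac\<close>.

  In part (b) the formula for \<open>N(X \<circ>\<^sub>N Y)\<close> is the vanishing of the torsion. Combined with the Leibniz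
  identity of \<open>\<circ>\<close>, it yields the Leibniz identity of \<open>\<circ>\<^sub>N\<close> on sections of \<open>L\<close>, although \<open>N\<close> need not
  map \<open>L\<close> into itself (\<open>contracted_leibniz\<close>); with skew-symmetry this is the Jacobi identity. The anchor
  is \<open>\<rho> \<circ> N\<close>, restricted to \<open>L\<close>. Its Leibniz rule (\<open>contracted_function_right\<close>) comes from the rule
  \<open>X \<circ> (f Y) = f (X \<circ> Y) + (\<rho>(X) f) Y\<close> of the Courant algebroid (\<open>circ_function_right\<close>), which itself is a
  consequence of the invariance of the metric.

  The arguments above compare sections by pairing them with all global sections, and so rest on the
  existence of a global section through any given vector (\<open>section_through\<close>). That in turn needs
  smooth bump functions and the compactness of closed coordinate balls. Moreover, \<open>N X\<close>, \<open>f Y\<close>,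
  \<open>\<langle>X, Y\<rangle>\<close> and \<open>\<rho> \<circ> N\<close> have to be smooth, which requires products and compositions of smooth maps.
\<close>

section \<open>Finite-dimensional inner product spaces\<close>

lemma finite_span_UNIV: "\<exists>B::'a::finite_dim_inner set. finite B \<and> span B = UNIV"
proof -
  obtain B :: "'a set" where B: "finite B" "\<And>x. \<exists>r. x = (\<Sum>b\<in>B. r b *\<^sub>R b)"
    using finite_spanning by blast
  have "x \<in> span B" for x
    using B(2)[of x] by (metis (no_types, lifting) span_sum span_scale span_base)
  with B(1) show ?thesis by blast
qed

text \<open>
  Bundle coordinates live in products such as \<open>'e \<times> 'f\<close>. Maps in these coordinates are composed,
  and the chain rule below needs the intermediate space to be finite-dimensional.
\<close>

instance prod :: (finite_dim_inner, finite_dim_inner) finite_dim_inner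
proof
  obtain B :: "'a set" where B: "finite B" "span B = UNIV" using finite_span_UNIV by blast
  obtain C :: "'b set" where C: "finite C" "span C = UNIV" using finite_span_UNIV by blast
  let ?D = "(\<lambda>b. (b, 0::'b)) ` B \<union> (\<lambda>c. (0::'a, c)) ` C"
  have fin: "finite ?D" using B C by simp
  have 1: "(x, 0) \<in> span ((\<lambda>b. (b, 0::'b)) ` B)" for x
  proof -
    have "linear (\<lambda>b::'a. (b, 0::'b))" by (rule linearI) auto
    from linear_span_image[OF this, of B] show ?thesis using B by auto
  qed
  have 2: "(0, y) \<in> span ((\<lambda>c. (0::'a, c)) ` C)" for y
  proof -
    have "linear (\<lambda>c::'b. (0::'a, c))" by (rule linearI) auto
    from linear_span_image[OF this, of C] show ?thesis using C by auto
  qed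
  have "z \<in> span ?D" for z :: "'a \<times> 'b"
  proof -
    have "(fst z, 0) \<in> span ?D" "(0, snd z) \<in> span ?D"
      using 1 2 span_mono[of "(\<lambda>b. (b, 0::'b)) ` B" ?D] span_mono[of "(\<lambda>c. (0::'a, c)) ` C" ?D]
      by blast+
    from span_add[OF this] show ?thesis by simp
  qed
  then have "\<exists>r. z = (\<Sum>b\<in>?D. r b *\<^sub>R b)" for z :: "'a \<times> 'b"
    using span_finite[OF fin] by (metis (no_types, lifting) imageE)
  with fin show "\<exists>B::('a \<times> 'b) set. finite B \<and> (\<forall>x. \<exists>r. x = (\<Sum>b\<in>B. r b *\<^sub>R b))"
    by blast
qed

definition orthonormal :: "'a::real_inner set \<Rightarrow> bool" where
  "orthonormal C \<longleftrightarrow> (\<forall>a\<in>C. \<forall>b\<in>C. inner a b = (if a = b then 1 else 0))"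

lemma inner_orthonormal_sum:
  assumes "finite C" "orthonormal C" "c \<in> C"
  shows "inner (\<Sum>b\<in>C. u b *\<^sub>R b) c = u c"
proof -
  have "inner (\<Sum>b\<in>C. u b *\<^sub>R b) c = (\<Sum>b\<in>C. if b = c then u b else 0)"
    unfolding inner_sum_left using assms by (intro sum.cong) (auto simp: orthonormal_def)
  then show ?thesis using assms by simp
qed

lemma gram_schmidt:
  fixes B :: "'a::real_inner set"
  assumes "finite B"
  shows "\<exists>C. finite C \<and> orthonormal C \<and> B \<subseteq> span C"
  using assms
proof (induction B)
  case empty
  then show ?case by (intro exI[of _ "{}"]) (auto simp: orthonormal_def)
next
  case (insert x B)
  then obtain C where C: "finite C" "orthonormal C" "B \<subseteq> span C" by blast
  define s where "s = (\<Sum>c\<in>C. inner x c *\<^sub>R c)"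
  define y where "y = x - s"
  have s: "s \<in> span C" unfolding s_def by (intro span_sum span_scale span_base)
  have orth: "inner y c = 0" if "c \<in> C" for c
    using inner_orthonormal_sum[OF C(1,2) that] by (simp add: y_def s_def inner_diff_left)
  show ?case
  proof (cases "y = 0")
    case True
    then have "x \<in> span C" using s by (simp add: y_def)
    with C show ?thesis by auto
  next
    case False
    define z where "z = (1 / norm y) *\<^sub>R y"
    have zz: "inner z z = 1" using False
      by (simp add: z_def dot_square_norm power2_eq_square)
    have zc: "inner z c = 0" "inner c z = 0" if "c \<in> C" for c
      using orth[OF that] by (simp_all add: z_def inner_commute)
    have "orthonormal (insert z C)"
      using C(2) zz zc unfolding orthonormal_def by auto
    moreover have "x \<in> span (insert z C)"
    proof -
      have "x = norm y *\<^sub>R z + s" using False by (simp add: z_def y_def)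
      moreover have "norm y *\<^sub>R z \<in> span (insert z C)" by (simp add: span_scale span_base)
      moreover have "s \<in> span (insert z C)" using s span_mono[of C "insert z C"] by blast
      ultimately show ?thesis by (metis span_add)
    qed
    moreover have "B \<subseteq> span (insert z C)" using C(3) span_mono[of C "insert z C"] by blast
    ultimately show ?thesis using C(1) by (intro exI[of _ "insert z C"]) auto
  qed
qed

lemma orthonormal_basis_exists:
  "\<exists>C::'a::finite_dim_inner set. finite C \<and> orthonormal C \<and> (\<forall>x. x = (\<Sum>c\<in>C. inner x c *\<^sub>R c))"
proof -
  obtain B :: "'a set" where B: "finite B" "span B = UNIV" using finite_span_UNIV by blast
  from gram_schmidt[OF B(1)] obtain C where C: "finite C" "orthonormal C" "B \<subseteq> span C" by blast
  have UN: "span C = UNIV" using span_mono[OF C(3)] B(2) by (simp add: span_span top_unique)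
  have "x = (\<Sum>c\<in>C. inner x c *\<^sub>R c)" for x
  proof -
    have "x \<in> span C" using UN by simp
    then obtain u where x: "x = (\<Sum>c\<in>C. u c *\<^sub>R c)" unfolding span_finite[OF C(1)] by auto
    also have "\<dots> = (\<Sum>c\<in>C. inner x c *\<^sub>R c)"
      using inner_orthonormal_sum[OF C(1,2), of _ u] x by (intro sum.cong) auto
    finally show ?thesis .
  qed
  with C show ?thesis by blast
qed

lemma compact_coefficient_box:
  fixes C :: "'a::real_normed_vector set"
  assumes "finite C"
  shows "compact {(\<Sum>c\<in>C. t c *\<^sub>R c) | t. \<forall>c\<in>C. \<bar>t c\<bar> \<le> r}"
  using assms
proof (induction C)
  case empty
  then show ?case by simp
next
  case (insert a C)
  let ?K = "{(\<Sum>c\<in>C. t c *\<^sub>R c) | t. \<forall>c\<in>C. \<bar>t c\<bar> \<le> r}"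
  let ?I = "(\<lambda>s. s *\<^sub>R a) ` {-r..r}"
  have "compact ?I" by (intro compact_continuous_image continuous_intros) simp
  then have "compact {x + y | x y. x \<in> ?I \<and> y \<in> ?K}" using insert.IH by (rule compact_sums)
  moreover have "{x + y | x y. x \<in> ?I \<and> y \<in> ?K} =
      {(\<Sum>c\<in>insert a C. t c *\<^sub>R c) | t. \<forall>c\<in>insert a C. \<bar>t c\<bar> \<le> r}" (is "?l = ?r")
  proof (intro subset_antisym subsetI)
    fix z assume "z \<in> ?l"
    then obtain s t where z: "z = s *\<^sub>R a + (\<Sum>c\<in>C. t c *\<^sub>R c)" "\<bar>s\<bar> \<le> r" "\<forall>c\<in>C. \<bar>t c\<bar> \<le> r"
      by (auto simp: abs_le_iff)
    have "(\<Sum>c\<in>C. (t(a := s)) c *\<^sub>R c) = (\<Sum>c\<in>C. t c *\<^sub>R c)"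
      using insert.hyps by (intro sum.cong) auto
    then show "z \<in> ?r" using z insert.hyps by (intro CollectI exI[of _ "t(a := s)"]) auto
  next
    fix z assume "z \<in> ?r"
    then obtain t where "z = t a *\<^sub>R a + (\<Sum>c\<in>C. t c *\<^sub>R c)" "\<bar>t a\<bar> \<le> r" "\<forall>c\<in>C. \<bar>t c\<bar> \<le> r"
      using insert.hyps by auto
    moreover from this have "t a *\<^sub>R a \<in> ?I" by (auto simp: abs_le_iff)
    ultimately show "z \<in> ?l" by blast
  qed
  ultimately show ?case by simp
qed

text \<open>
  By Cauchy-Schwarz, the coefficients with respect to an orthonormal basis are bounded by the norm,
  so a closed ball is a closed subset of a compact box.
\<close>

lemma compact_cball_finite_dim: "compact (cball (x::'a::finite_dim_inner) r)"
proof -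
  obtain C :: "'a set" where C: "finite C" "orthonormal C" "\<And>x. x = (\<Sum>c\<in>C. inner x c *\<^sub>R c)"
    using orthonormal_basis_exists by blast
  let ?K = "{(\<Sum>c\<in>C. t c *\<^sub>R c) | t. \<forall>c\<in>C. \<bar>t c\<bar> \<le> norm x + r}"
  have "cball x r \<subseteq> ?K"
  proof
    fix y assume "y \<in> cball x r"
    then have y: "norm y \<le> norm x + r"
      using norm_triangle_ineq2[of y x] by (simp add: dist_norm norm_minus_commute)
    have "\<bar>inner y c\<bar> \<le> norm x + r" if "c \<in> C" for c
    proof -
      have "norm c = 1" using C(2) that by (simp add: orthonormal_def norm_eq_sqrt_inner)
      then show ?thesis using Cauchy_Schwarz_ineq2[of y c] y by simp
    qed
    then show "y \<in> ?K" using C(3)[of y] by blast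
  qed
  then show ?thesis
    using closed_Int_compact[OF closed_cball compact_coefficient_box[OF C(1)], of x r "norm x + r"]
    by (simp add: Int_absorb2)
qed

section \<open>Calculus of smooth maps\<close>

lemma frechet_derivative_cong_open:
  assumes "open S" "x \<in> S" "\<And>y. y \<in> S \<Longrightarrow> f y = g y"
  shows "frechet_derivative f (at x) = frechet_derivative g (at x)"
    and "f differentiable (at x) \<longleftrightarrow> g differentiable (at x)"
proof -
  have "(f has_derivative D) (at x) \<longleftrightarrow> (g has_derivative D) (at x)" for D
    using has_derivative_transform_within_open[of f D x UNIV S g]
      has_derivative_transform_within_open[of g D x UNIV S f] assms by auto
  then show "frechet_derivative f (at x) = frechet_derivative g (at x)"
    "f differentiable (at x) \<longleftrightarrow> g differentiable (at x)"
    by (simp_all add: frechet_derivative_def differentiable_def)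
qed

lemma Ck_on_cong:
  assumes "open S" "\<And>x. x \<in> S \<Longrightarrow> f x = g x"
  shows "Ck_on k S f \<longleftrightarrow> Ck_on k S g"
  using assms(2)
proof (induction k arbitrary: f g)
  case 0
  then show ?case by (simp cong: continuous_on_cong)
next
  case (Suc k)
  have "Ck_on k S (\<lambda>x. frechet_derivative f (at x) v) \<longleftrightarrow>
      Ck_on k S (\<lambda>x. frechet_derivative g (at x) v)" for v
    using frechet_derivative_cong_open(1)[of S _ f g] Suc.prems assms(1) by (intro Suc.IH) auto
  then show ?case
    using frechet_derivative_cong_open(2)[of S _ f g] Suc.prems assms(1) by auto
qed

lemma smooth_on_cong:
  assumes "open S" "\<And>x. x \<in> S \<Longrightarrow> f x = g x"
  shows "smooth_on S f \<longleftrightarrow> smooth_on S g"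
  using Ck_on_cong[OF assms] by (simp add: smooth_on_def)

lemma Ck_on_subset: "Ck_on k T f \<Longrightarrow> S \<subseteq> T \<Longrightarrow> Ck_on k S f"
  by (induction k arbitrary: f) (auto intro: continuous_on_subset)

lemma smooth_on_subset: "smooth_on T f \<Longrightarrow> S \<subseteq> T \<Longrightarrow> smooth_on S f"
  by (auto simp: smooth_on_def intro: Ck_on_subset)

text \<open>
  Differentiability, demanded at the next order, supplies the continuity that the order below asks for.
\<close>

lemma Ck_on_lower: "Ck_on (Suc k) S f \<Longrightarrow> Ck_on k S f"
proof (induction k arbitrary: f)
  case 0
  then show ?case
    by (auto intro!: continuous_at_imp_continuous_on differentiable_imp_continuous_within)
next
  case (Suc k)
  show ?case
    unfolding Ck_on.simps(2)
  proof (intro conjI ballI allI)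
    show "f differentiable (at x)" if "x \<in> S" for x
      using Suc.prems that by simp
    show "Ck_on k S (\<lambda>x. frechet_derivative f (at x) v)" for v
      using Suc.prems by (intro Suc.IH) (subst (asm) Ck_on.simps(2), blast)
  qed
qed

text \<open>
  All clauses in the definition of smoothness are local. This makes it possible to verify smoothness
  around each point in a chart or trivialisation suited to that point.
\<close>

lemma smooth_on_local:
  assumes "\<And>x. x \<in> S \<Longrightarrow> \<exists>U. open U \<and> x \<in> U \<and> smooth_on U f"
  shows "smooth_on S f"
proof -
  have Ck_local: "Ck_on k S f" if "\<And>x. x \<in> S \<Longrightarrow> \<exists>U. open U \<and> x \<in> U \<and> Ck_on k U f" for k
    using that
  proof (induction k arbitrary: f)
    case 0
    then show ?case
      unfolding Ck_on.simps(1)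
      by (intro continuous_at_imp_continuous_on ballI) (metis continuous_on_eq_continuous_at)
  next
    case (Suc k)
    show ?case
      unfolding Ck_on.simps(2)
    proof (intro conjI ballI allI)
      show "f differentiable (at x)" if "x \<in> S" for x
        using Suc.prems[OF that] by auto
      show "Ck_on k S (\<lambda>x. frechet_derivative f (at x) v)" for v
        using Suc.prems by (intro Suc.IH) fastforce
    qed
  qed
  show ?thesis
    unfolding smooth_on_def
  proof (intro allI Ck_local)
    fix k x assume "x \<in> S"
    from assms[OF this] show "\<exists>U. open U \<and> x \<in> U \<and> Ck_on k U f" by (auto simp: smooth_on_def)
  qed
qed

text \<open>
  The derivative in \<open>Ck_on\<close> is the selected \<open>frechet_derivative\<close>. On an open set uniqueness of
  derivatives replaces it by an explicit formula, which is how the calculus rules below proceed.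
\<close>

lemma Ck_on_SucI:
  assumes "open S" "\<And>x. x \<in> S \<Longrightarrow> (f has_derivative D x) (at x)" "\<And>v. Ck_on k S (\<lambda>x. D x v)"
  shows "Ck_on (Suc k) S f"
proof -
  have "frechet_derivative f (at x) = D x" if "x \<in> S" for x
    using frechet_derivative_at[OF assms(2)[OF that]] by simp
  then have "Ck_on k S (\<lambda>x. frechet_derivative f (at x) v)" for v
    using Ck_on_cong[OF assms(1), of "\<lambda>x. frechet_derivative f (at x) v" "\<lambda>x. D x v" k] assms(3)
    by auto
  with assms(2) show ?thesis by (auto simp: differentiable_def)
qed

lemma Ck_on_const [simp]: "Ck_on k S (\<lambda>x. c)"
  by (induction k arbitrary: c) (auto simp: frechet_derivative_const)

lemma Ck_on_bounded_linear:
  assumes "bounded_linear f"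
  shows "Ck_on k S f"
proof -
  have D: "(f has_derivative f) (at x)" for x
    using assms by (rule bounded_linear_imp_has_derivative)
  then have "frechet_derivative f (at x) = f" for x
    by (metis frechet_derivative_at)
  with D show ?thesis
    by (cases k) (auto simp: differentiable_def intro: linear_continuous_on assms)
qed

lemma Ck_on_linear_comp:
  assumes "open S" "bounded_linear h" "Ck_on k S f"
  shows "Ck_on k S (\<lambda>x. h (f x))"
  using assms(3)
proof (induction k arbitrary: f)
  case 0
  then show ?case using assms(2) by (auto intro: bounded_linear.continuous_on)
next
  case (Suc k)
  have D: "((\<lambda>x. h (f x)) has_derivative (\<lambda>v. h (frechet_derivative f (at x) v))) (at x)"
    if "x \<in> S" for x
    using Suc.prems that bounded_linear.has_derivative[OF assms(2)]
    by (auto simp: frechet_derivative_works)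
  have "Ck_on k S (\<lambda>x. h (frechet_derivative f (at x) v))" for v
    using Suc by auto
  with D show ?case by (intro Ck_on_SucI[OF assms(1)])
qed

lemma Ck_on_add:
  assumes "open S" "Ck_on k S f" "Ck_on k S g"
  shows "Ck_on k S (\<lambda>x. f x + g x)"
  using assms(2,3)
proof (induction k arbitrary: f g)
  case 0
  then show ?case by (auto intro: continuous_on_add)
next
  case (Suc k)
  have D: "((\<lambda>x. f x + g x) has_derivative
      (\<lambda>v. frechet_derivative f (at x) v + frechet_derivative g (at x) v)) (at x)"
    if "x \<in> S" for x
    using Suc.prems that by (auto simp: frechet_derivative_works intro!: has_derivative_add)
  have "Ck_on k S (\<lambda>x. frechet_derivative f (at x) v + frechet_derivative g (at x) v)" for v
    using Suc by auto
  with D show ?case by (intro Ck_on_SucI[OF assms(1)])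
qed

lemma Ck_on_sum:
  assumes "open S" "finite I" "\<And>i. i \<in> I \<Longrightarrow> Ck_on k S (f i)"
  shows "Ck_on k S (\<lambda>x. \<Sum>i\<in>I. f i x)"
  using assms(2,3) by (induction I) (auto intro: Ck_on_add[OF assms(1)])

lemma Ck_on_bilinear:
  assumes "open S" "bounded_bilinear m" "Ck_on k S f" "Ck_on k S g"
  shows "Ck_on k S (\<lambda>x. m (f x) (g x))"
  using assms(3,4)
proof (induction k arbitrary: f g)
  case 0
  then show ?case using bounded_bilinear.continuous_on[OF assms(2)] by auto
next
  case (Suc k)
  have D: "((\<lambda>x. m (f x) (g x)) has_derivative
      (\<lambda>v. m (f x) (frechet_derivative g (at x) v) + m (frechet_derivative f (at x) v) (g x))) (at x)"
    if "x \<in> S" for x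
    using Suc.prems that
    by (intro bounded_bilinear.FDERIV[OF assms(2)]) (auto simp: frechet_derivative_works)
  have "Ck_on k S f" "Ck_on k S g" using Suc.prems by (auto intro: Ck_on_lower)
  then have "Ck_on k S (\<lambda>x. m (f x) (frechet_derivative g (at x) v) +
      m (frechet_derivative f (at x) v) (g x))" for v
    using Suc by (auto intro!: Ck_on_add[OF assms(1)])
  with D show ?case by (intro Ck_on_SucI[OF assms(1)])
qed

lemma Ck_on_Pair:
  assumes "open S" "Ck_on k S f" "Ck_on k S g"
  shows "Ck_on k S (\<lambda>x. (f x, g x))"
proof -
  have "bounded_linear (\<lambda>a. (a, 0))" "bounded_linear (\<lambda>b. (0, b))"
    by (auto intro!: bounded_linear_Pair bounded_linear_ident bounded_linear_zero)
  from Ck_on_add[OF assms(1) Ck_on_linear_comp[OF assms(1) this(1) assms(2)]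
      Ck_on_linear_comp[OF assms(1) this(2) assms(3)]]
  show ?thesis by simp
qed

text \<open>
  In the chain rule \<open>D(f \<circ> g)(x) v = Df(g x) (Dg(x) v)\<close> the direction in which \<open>f\<close> is differentiated
  depends on \<open>x\<close>, whereas \<open>Ck_on\<close> speaks of fixed directions. Expanding the direction in an orthonormal
  basis \<open>C\<close> of the intermediate space gives the finite sum of the terms
  \<open>\<langle>Dg(x) v, c\<rangle> Df(g x) c\<close>, to which the product rule and the induction hypothesis apply.
\<close>

lemma Ck_on_compose:
  fixes g :: "'a::real_normed_vector \<Rightarrow> 'b::finite_dim_inner"
    and f :: "'b \<Rightarrow> 'c::real_normed_vector"
  assumes "open S" "open T" "g ` S \<subseteq> T" "Ck_on k T f" "Ck_on k S g"
  shows "Ck_on k S (\<lambda>x. f (g x))"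
  using assms(4,5)
proof (induction k arbitrary: f)
  case 0
  then show ?case using assms(3) by (auto intro: continuous_on_compose2)
next
  case (Suc k)
  obtain C :: "'b set" where C: "finite C" "\<And>x. x = (\<Sum>c\<in>C. inner x c *\<^sub>R c)"
    using orthonormal_basis_exists by blast
  have df: "(f has_derivative frechet_derivative f (at y)) (at y)" if "y \<in> T" for y
    using Suc.prems(1) that by (simp add: frechet_derivative_works)
  have D: "((\<lambda>x. f (g x)) has_derivative
      (\<lambda>v. \<Sum>c\<in>C. inner (frechet_derivative g (at x) v) c *\<^sub>R frechet_derivative f (at (g x)) c)) (at x)"
    if "x \<in> S" for x
  proof -
    have gx: "g x \<in> T" using assms(3) that by blast
    have dg: "(g has_derivative frechet_derivative g (at x)) (at x)"
      using Suc.prems(2) that by (simp add: frechet_derivative_works)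
    have lin: "linear (frechet_derivative f (at (g x)))"
      using df[OF gx] by (rule has_derivative_linear)
    have expand: "frechet_derivative f (at (g x)) w =
        (\<Sum>c\<in>C. inner w c *\<^sub>R frechet_derivative f (at (g x)) c)" for w
      using arg_cong[OF C(2)[of w], of "frechet_derivative f (at (g x))"]
      by (simp only: linear_sum[OF lin] linear_scale[OF lin])
    show ?thesis
      by (rule has_derivative_eq_rhs[OF has_derivative_compose[OF dg df[OF gx]]])
        (rule ext, rule expand)
  qed
  have "Ck_on k S (\<lambda>x. \<Sum>c\<in>C. inner (frechet_derivative g (at x) v) c *\<^sub>R
      frechet_derivative f (at (g x)) c)" for v
  proof (intro Ck_on_sum[OF assms(1) C(1)]
      Ck_on_bilinear[OF assms(1) bounded_bilinear_scaleR])
    fix c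
    show "Ck_on k S (\<lambda>x. inner (frechet_derivative g (at x) v) c)"
      using Suc.prems(2)
      by (intro Ck_on_linear_comp[OF assms(1) bounded_linear_inner_left]) simp
    have "Ck_on k T (\<lambda>y. frechet_derivative f (at y) c)" using Suc.prems(1) by simp
    then show "Ck_on k S (\<lambda>x. frechet_derivative f (at (g x)) c)"
      by (rule Suc.IH) (rule Ck_on_lower[OF Suc.prems(2)])
  qed
  with D show ?case by (intro Ck_on_SucI[OF assms(1)])
qed

lemma smooth_on_const: "smooth_on S (\<lambda>x. c)"
  by (simp add: smooth_on_def)

lemma smooth_on_bounded_linear: "bounded_linear f \<Longrightarrow> smooth_on S f"
  by (simp add: smooth_on_def Ck_on_bounded_linear)

lemma smooth_on_add:
  "open S \<Longrightarrow> smooth_on S f \<Longrightarrow> smooth_on S g \<Longrightarrow> smooth_on S (\<lambda>x. f x + g x)"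
  by (simp add: smooth_on_def Ck_on_add)

lemma smooth_on_bilinear:
  "open S \<Longrightarrow> bounded_bilinear m \<Longrightarrow> smooth_on S f \<Longrightarrow> smooth_on S g \<Longrightarrow>
    smooth_on S (\<lambda>x. m (f x) (g x))"
  by (simp add: smooth_on_def Ck_on_bilinear)

lemmas smooth_on_scaleR = smooth_on_bilinear[OF _ bounded_bilinear_scaleR]

lemma smooth_on_Pair:
  "open S \<Longrightarrow> smooth_on S f \<Longrightarrow> smooth_on S g \<Longrightarrow> smooth_on S (\<lambda>x. (f x, g x))"
  by (simp add: smooth_on_def Ck_on_Pair)

lemma smooth_on_compose:
  fixes g :: "'a::real_normed_vector \<Rightarrow> 'b::finite_dim_inner"
  assumes "open S" "open T" "g ` S \<subseteq> T" "smooth_on T f" "smooth_on S g"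
  shows "smooth_on S (\<lambda>x. f (g x))"
  using assms by (simp add: smooth_on_def Ck_on_compose)

lemma smooth_on_differentiable: "smooth_on S f \<Longrightarrow> x \<in> S \<Longrightarrow> f differentiable (at x)"
  unfolding smooth_on_def by (metis Ck_on.simps(2))

section \<open>Smooth bump functions\<close>

text \<open>
  The function \<open>exp (- 1 / t)\<close> is multiplied by powers of \<open>1 / t\<close> because the resulting family is
  closed, up to linear combinations, under differentiation.
\<close>

definition flat :: "nat \<Rightarrow> real \<Rightarrow> real" where
  "flat n t = (if t > 0 then inverse t ^ n / exp (inverse t) else 0)"

lemma flat_tendsto_0: "(flat n \<longlongrightarrow> 0) (at_right 0)"
proof -
  have "((\<lambda>t. inverse t ^ n / exp (inverse t)) \<longlongrightarrow> 0) (at_right (0::real))"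
    by (rule filterlim_compose[OF tendsto_power_div_exp_0 filterlim_inverse_at_top_right])
  then show ?thesis
    by (rule Lim_transform_eventually)
      (auto simp: eventually_at_filter flat_def)
qed

lemma flat_DERIV: "(flat n has_real_derivative flat (n + 2) t - real n * flat (n + 1) t) (at t)"
proof -
  consider "t > 0" | "t < 0" | "t = 0" by linarith
  then show ?thesis
  proof cases
    case 1
    have "((\<lambda>t. inverse t ^ n / exp (inverse t)) has_real_derivative
        flat (n + 2) t - real n * flat (n + 1) t) (at t)"
      using 1
      by (auto intro!: derivative_eq_intros simp: flat_def)
        (cases n; auto simp: field_simps power2_eq_square)
    then show ?thesis
      by (rule has_field_derivative_transform_within_open[where S = "{0<..}"])
        (use 1 in \<open>auto simp: flat_def\<close>)
  next
    case 2
    have "((\<lambda>t. 0) has_real_derivative flat (n + 2) t - real n * flat (n + 1) t) (at t)"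
      using 2 by (simp add: flat_def)
    then show ?thesis
      by (rule has_field_derivative_transform_within_open[where S = "{..<0}"])
        (use 2 in \<open>auto simp: flat_def\<close>)
  next
    case 3
    (* for h > 0 the difference quotient is again a member of the family *)
    have "((\<lambda>h. flat n h / h) \<longlongrightarrow> 0) (at_right 0)"
      using flat_tendsto_0[of "Suc n"]
      by (rule Lim_transform_eventually)
        (auto simp: eventually_at_filter flat_def field_simps)
    moreover have "((\<lambda>h. flat n h / h) \<longlongrightarrow> 0) (at_left 0)"
      by (rule Lim_transform_eventually[OF tendsto_const])
        (auto simp: eventually_at_filter flat_def)
    ultimately have "((\<lambda>h. flat n h / h) \<longlongrightarrow> 0) (at 0)"
      by (simp add: filterlim_at_split)
    then show ?thesis
      using 3 by (simp add: DERIV_def flat_def)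
  qed
qed

lemma smooth_on_flat: "smooth_on UNIV (flat n)"
proof -
  have "Ck_on k UNIV (flat n)" for k
  proof (induction k arbitrary: n)
    case 0
    then show ?case
      using flat_DERIV by (auto intro!: continuous_at_imp_continuous_on DERIV_isCont)
  next
    case (Suc k)
    have fd: "frechet_derivative (flat n) (at x) v = v *\<^sub>R flat (n + 2) x + (- real n * v) *\<^sub>R flat (n + 1) x"
      for x v
      using frechet_derivative_at[OF flat_DERIV[of n x, unfolded has_field_derivative_def], symmetric]
      by (simp add: algebra_simps)
    have "Ck_on k UNIV (\<lambda>x. v *\<^sub>R flat (n + 2) x + (- real n * v) *\<^sub>R flat (n + 1) x)" for v
      by (intro Ck_on_add Ck_on_linear_comp[OF _ bounded_linear_scaleR_right] Suc.IH open_UNIV)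
    then show ?case
      using flat_DERIV[of n] by (auto simp: fd differentiable_def has_field_derivative_def)
  qed
  then show ?thesis by (simp add: smooth_on_def)
qed

text \<open>
  The witness is \<open>flat 0 (r\<^sup>2 - \<parallel>x - x0\<parallel>\<^sup>2)\<close>, normalised at \<open>x0\<close>; the square of the norm is smooth
  because the inner product is bilinear.
\<close>

lemma bump_function_exists:
  fixes x0 :: "'e::real_inner"
  assumes "r > 0"
  shows "\<exists>b::'e \<Rightarrow> real. smooth_on UNIV b \<and> b x0 = 1 \<and> (\<forall>x. x \<notin> cball x0 r \<longrightarrow> b x = 0)"
proof -
  (* sums, multiples and products only, to match the closure rules for smooth_on *)
  define q where "q x = r\<^sup>2 + (-1) *\<^sub>R inner (x + - x0) (x + - x0)" for x
  define b where "b x = inverse (flat 0 (r\<^sup>2)) *\<^sub>R flat 0 (q x)" for x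
  have "smooth_on UNIV q"
    unfolding q_def
    by (intro smooth_on_add open_UNIV smooth_on_const smooth_on_bounded_linear bounded_linear_ident
        smooth_on_scaleR smooth_on_bilinear[OF _ bounded_bilinear_inner])
  then have "smooth_on UNIV (\<lambda>x. flat 0 (q x))"
    by (intro smooth_on_compose[OF _ _ _ smooth_on_flat]) auto
  then have "smooth_on UNIV b"
    unfolding b_def by (intro smooth_on_scaleR smooth_on_const open_UNIV)
  moreover have "b x0 = 1" using assms by (simp add: b_def q_def flat_def)
  moreover have "b x = 0" if "x \<notin> cball x0 r" for x
  proof -
    have "r < norm (x - x0)" using that by (simp add: dist_norm norm_minus_commute)
    then have "r\<^sup>2 \<le> (norm (x - x0))\<^sup>2" using assms by (intro power_mono) auto
    then have "q x \<le> 0" by (simp add: q_def power2_norm_eq_inner)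
    then show ?thesis by (simp add: b_def flat_def)
  qed
  ultimately show ?thesis by blast
qed

section \<open>Smooth functions on manifolds\<close>

context smooth_manifold
begin

lemma chart_inv_chart:
  assumes "c \<in> \<A>" "p \<in> fst c"
  shows "chart_inv c (snd c p) = p"
  using charts[OF assms(1)] assms(2) by (auto simp: homeomorphism_def)

lemma open_chart_image:
  assumes "c \<in> \<A>" "open U"
  shows "open (snd c ` (fst c \<inter> U))"
proof -
  have h: "homeomorphism (fst c) (snd c ` fst c) (snd c) (chart_inv c)" "open (snd c ` fst c)"
    using charts[OF assms(1)] by auto
  have "snd c ` (fst c \<inter> U) = snd c ` fst c \<inter> chart_inv c -` U"
    using chart_inv_chart[OF assms(1)] by auto
  then show ?thesis
    using h assms(2) continuous_open_preimage[of "snd c ` fst c" "chart_inv c" U]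
    by (auto simp: homeomorphism_def)
qed

lemma pref_chart: "pref_chart \<A> p \<in> \<A>" "p \<in> fst (pref_chart \<A> p)"
proof -
  have "\<exists>c. c \<in> \<A> \<and> p \<in> fst c" using cover by blast
  from someI_ex[OF this] show "pref_chart \<A> p \<in> \<A>" "p \<in> fst (pref_chart \<A> p)"
    by (auto simp: pref_chart_def)
qed

lemma smooth_map_onI_local:
  assumes "\<And>p. p \<in> U \<Longrightarrow> \<exists>V. open V \<and> p \<in> V \<and> smooth_map_on \<A> V f"
  shows "smooth_map_on \<A> U f"
  unfolding smooth_map_on_def
proof (intro ballI smooth_on_local)
  fix c x assume c: "c \<in> \<A>" and "x \<in> snd c ` (fst c \<inter> U)"
  then obtain p where p: "p \<in> fst c" "p \<in> U" "x = snd c p" by auto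
  from assms[OF p(2)] obtain V where V: "open V" "p \<in> V" "smooth_map_on \<A> V f" by blast
  then show "\<exists>W. open W \<and> x \<in> W \<and> smooth_on W (f \<circ> chart_inv c)"
    using p c open_chart_image[OF c V(1)]
    by (intro exI[of _ "snd c ` (fst c \<inter> V)"]) (auto simp: smooth_map_on_def)
qed

lemma smooth_map_on_subset: "smooth_map_on \<A> V f \<Longrightarrow> U \<subseteq> V \<Longrightarrow> smooth_map_on \<A> U f"
  unfolding smooth_map_on_def by (meson Int_mono image_mono order_refl smooth_on_subset)

lemma smooth_map_on_cong:
  assumes "open U" "\<And>p. p \<in> U \<Longrightarrow> f p = h p"
  shows "smooth_map_on \<A> U f \<longleftrightarrow> smooth_map_on \<A> U h"
  unfolding smooth_map_on_def
proof (intro ball_cong refl smooth_on_cong open_chart_image assms(1))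
  fix c x assume "c \<in> \<A>" "x \<in> snd c ` (fst c \<inter> U)"
  then show "(f \<circ> chart_inv c) x = (h \<circ> chart_inv c) x"
    using assms(2) chart_inv_chart[of c] by auto
qed

lemma smooth_map_on_const: "smooth_map_on \<A> U (\<lambda>p. k)"
  by (simp add: smooth_map_on_def o_def smooth_on_const)

lemma smooth_map_on_add:
  "open U \<Longrightarrow> smooth_map_on \<A> U f \<Longrightarrow> smooth_map_on \<A> U h \<Longrightarrow> smooth_map_on \<A> U (\<lambda>p. f p + h p)"
  unfolding smooth_map_on_def o_def by (auto intro!: smooth_on_add open_chart_image)

lemma smooth_map_on_scaleR:
  "open U \<Longrightarrow> smooth_map_on \<A> U f \<Longrightarrow> smooth_map_on \<A> U h \<Longrightarrow> smooth_map_on \<A> U (\<lambda>p. f p *\<^sub>R h p)"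
  unfolding smooth_map_on_def o_def by (auto intro!: smooth_on_scaleR open_chart_image)

lemma smooth_map_on_compose_chart:
  assumes "c \<in> \<A>" "smooth_on UNIV b"
  shows "smooth_map_on \<A> (fst c) (\<lambda>p. b (snd c p))"
  unfolding smooth_map_on_def
proof (intro ballI)
  fix d assume d: "d \<in> \<A>"
  have "open (snd d ` (fst d \<inter> fst c))"
    using open_chart_image[OF d] charts[OF assms(1)] by blast
  then show "smooth_on (snd d ` (fst d \<inter> fst c)) ((\<lambda>p. b (snd c p)) \<circ> chart_inv d)"
    using smooth_on_compose[OF _ open_UNIV _ assms(2) compatible[OF d assms(1)]]
    by (simp add: o_def)
qed

lemma smooth_map_has_derivative:
  assumes "smooth_map_on \<A> UNIV f"
  shows "((\<lambda>x. f (chart_inv (pref_chart \<A> p) x)) has_derivative tangent_map \<A> f p)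
    (at (snd (pref_chart \<A> p) p))"
proof -
  have "(f \<circ> chart_inv (pref_chart \<A> p)) differentiable (at (snd (pref_chart \<A> p) p))"
    using assms pref_chart[of p]
    by (intro smooth_on_differentiable[of "snd (pref_chart \<A> p) ` fst (pref_chart \<A> p)"])
      (auto simp: smooth_map_on_def)
  then show ?thesis
    by (simp add: frechet_derivative_works tangent_map_def[abs_def] o_def)
qed

lemma deriv_along_add:
  assumes "smooth_map_on \<A> UNIV f" "smooth_map_on \<A> UNIV h"
  shows "deriv_along \<A> V (\<lambda>p. f p + h p) p = deriv_along \<A> V f p + deriv_along \<A> V h p"
  using frechet_derivative_at[OF has_derivative_add[OF smooth_map_has_derivative[OF assms(1), of p]
        smooth_map_has_derivative[OF assms(2), of p]]]
  by (simp add: deriv_along_def tangent_map_def[of _ "\<lambda>p. f p + h p"] o_def fun_eq_iff)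

lemma deriv_along_mult:
  assumes "smooth_map_on \<A> UNIV f" "smooth_map_on \<A> UNIV h"
  shows "deriv_along \<A> V (\<lambda>p. f p * h p) p = f p * deriv_along \<A> V h p + deriv_along \<A> V f p * h p"
  using frechet_derivative_at[OF has_derivative_mult[OF smooth_map_has_derivative[OF assms(1), of p]
        smooth_map_has_derivative[OF assms(2), of p]]] chart_inv_chart[OF pref_chart]
  by (simp add: deriv_along_def tangent_map_def[of _ "\<lambda>p. f p * h p"] o_def fun_eq_iff)

end

section \<open>Sections of vector bundles\<close>

lemma Sec_fibre: "X \<in> Sec \<A> E \<Longrightarrow> X p \<in> fibre E p"
  by (simp add: Sec_def)

lemma linear_on_add: "linear_on S f \<Longrightarrow> x \<in> S \<Longrightarrow> y \<in> S \<Longrightarrow> f (x + y) = f x + f y"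
  by (simp add: linear_on_def)

lemma linear_on_scale: "linear_on S f \<Longrightarrow> x \<in> S \<Longrightarrow> f (r *\<^sub>R x) = r *\<^sub>R f x"
  by (simp add: linear_on_def)

lemma linear_on_diff:
  assumes "linear_on S f" "subspace S" "x \<in> S" "y \<in> S"
  shows "f (x - y) = f x - f y"
  using linear_on_add[OF assms(1), of "x - y" y] assms(2-) by (simp add: subspace_diff)

context vector_bundle
begin

lemma triv_inv_mem: "t \<in> trivs E \<Longrightarrow> p \<in> fst t \<Longrightarrow> triv_inv E t p w \<in> fibre E p"
  using triv_iso[of t p] unfolding triv_inv_def
  by (metis UNIV_I bij_betw_imp_surj_on inv_into_into)

lemma triv_inv_triv:
  "t \<in> trivs E \<Longrightarrow> p \<in> fst t \<Longrightarrow> v \<in> fibre E p \<Longrightarrow> triv_inv E t p (snd t p v) = v"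
  using triv_iso[of t p] unfolding triv_inv_def by (metis bij_betw_inv_into_left)

lemma triv_at: obtains t where "t \<in> trivs E" "p \<in> fst t"
  using triv_cover by blast

lemma Sec_smooth: "X \<in> Sec \<A> E \<Longrightarrow> t \<in> trivs E \<Longrightarrow> smooth_map_on \<A> (fst t) (\<lambda>p. snd t p (X p))"
  by (simp add: Sec_def)

lemma Sec_add:
  assumes "X \<in> Sec \<A> E" "Y \<in> Sec \<A> E"
  shows "(\<lambda>p. X p + Y p) \<in> Sec \<A> E"
proof -
  have "smooth_map_on \<A> (fst t) (\<lambda>p. snd t p (X p + Y p))" if t: "t \<in> trivs E" for t
    using smooth_map_on_add[OF triv_open[OF t] Sec_smooth[OF assms(1) t] Sec_smooth[OF assms(2) t]]
    by (rule smooth_map_on_cong[OF triv_open[OF t], THEN iffD1, rotated])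
      (simp add: linear_on_add[OF conjunct1[OF triv_iso[OF t]]] Sec_fibre[OF assms(1)] Sec_fibre[OF assms(2)])
  then show ?thesis
    using subspace_add[OF subspace_fibre Sec_fibre[OF assms(1)] Sec_fibre[OF assms(2)]]
    by (simp add: Sec_def)
qed

lemma Sec_scaleR:
  assumes "smooth_map_on \<A> UNIV f" "X \<in> Sec \<A> E"
  shows "(\<lambda>p. f p *\<^sub>R X p) \<in> Sec \<A> E"
proof -
  have "smooth_map_on \<A> (fst t) (\<lambda>p. snd t p (f p *\<^sub>R X p))" if t: "t \<in> trivs E" for t
    using smooth_map_on_scaleR[OF triv_open[OF t] smooth_map_on_subset[OF assms(1) subset_UNIV]
        Sec_smooth[OF assms(2) t]]
    by (rule smooth_map_on_cong[OF triv_open[OF t], THEN iffD1, rotated])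
      (simp add: linear_on_scale[OF conjunct1[OF triv_iso[OF t]]] Sec_fibre[OF assms(2)])
  then show ?thesis
    using subspace_scale[OF subspace_fibre Sec_fibre[OF assms(2)]] by (simp add: Sec_def)
qed

lemma Sec_cmult: "X \<in> Sec \<A> E \<Longrightarrow> (\<lambda>p. r *\<^sub>R X p) \<in> Sec \<A> E"
  by (intro Sec_scaleR smooth_map_on_const)

lemma Sec_diff:
  assumes "X \<in> Sec \<A> E" "Y \<in> Sec \<A> E"
  shows "(\<lambda>p. X p - Y p) \<in> Sec \<A> E"
  using Sec_add[OF assms(1) Sec_cmult[OF assms(2), of "-1"]] by simp

text \<open>
  Over a coordinate ball the constant section in a trivialisation is multiplied by a bump function
  and extended by zero. The extension is smooth because the closed ball is compact, so that its
  preimage is closed in the Hausdorff space \<open>'m\<close>.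
\<close>

lemma section_through:
  assumes "u \<in> fibre E p"
  obtains Z where "Z \<in> Sec \<A> E" "Z p = u"
proof -
  obtain c where c: "c \<in> \<A>" "p \<in> fst c" using cover by blast
  obtain t where t: "t \<in> trivs E" "p \<in> fst t" by (rule triv_at)
  define U where "U = fst c \<inter> fst t"
  have openU: "open U" using charts[OF c(1)] triv_open[OF t(1)] by (auto simp: U_def)
  have "open (snd c ` U)" unfolding U_def by (rule open_chart_image[OF c(1) triv_open[OF t(1)]])
  moreover have "snd c p \<in> snd c ` U" using c t by (auto simp: U_def)
  ultimately obtain r where r: "r > 0" "cball (snd c p) r \<subseteq> snd c ` U"
    using open_contains_cball by blast
  obtain b :: "'e \<Rightarrow> real" where b: "smooth_on UNIV b" "b (snd c p) = 1"
      "\<And>x. x \<notin> cball (snd c p) r \<Longrightarrow> b x = 0"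
    using bump_function_exists[OF r(1)] by blast
  define K where "K = chart_inv c ` cball (snd c p) r"
  have "continuous_on (cball (snd c p) r) (chart_inv c)"
    using charts[OF c(1)] r(2) by (auto simp: homeomorphism_def U_def intro: continuous_on_subset)
  then have "closed K"
    unfolding K_def by (intro compact_imp_closed compact_continuous_image compact_cball_finite_dim)
  have outside: "b (snd c q) = 0" if "q \<in> U" "q \<notin> K" for q
    using that b(3)[of "snd c q"] chart_inv_chart[OF c(1), of q] by (force simp: K_def U_def)
  define Z where "Z q = (if q \<in> U then b (snd c q) *\<^sub>R triv_inv E t q (snd t p u) else 0)" for q
  have "smooth_map_on \<A> (fst s) (\<lambda>q. snd s q (Z q))" if s: "s \<in> trivs E" for s
  proof (rule smooth_map_onI_local)
    fix q assume q: "q \<in> fst s"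
    note lin = conjunct1[OF triv_iso[OF s]]
    show "\<exists>V. open V \<and> q \<in> V \<and> smooth_map_on \<A> V (\<lambda>q. snd s q (Z q))"
    proof (cases "q \<in> U")
      case True
      let ?V = "fst t \<inter> fst s \<inter> U"
      have V: "open ?V" using triv_open[OF t(1)] triv_open[OF s] openU by blast
      have "smooth_map_on \<A> ?V (\<lambda>q. snd s q (triv_inv E t q (snd t p u)))"
        unfolding smooth_map_on_def
      proof (intro ballI)
        fix d assume d: "d \<in> \<A>"
        have o1: "open (snd d ` (fst d \<inter> ?V))" by (rule open_chart_image[OF d V])
        have "open (fst t \<inter> fst s)" using triv_open[OF t(1)] triv_open[OF s] by blast
        from open_Times[OF open_chart_image[OF d this] open_UNIV]
        have o2: "open ((snd d ` (fst d \<inter> fst t \<inter> fst s)) \<times> (UNIV :: 'f set))"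
          by (simp add: Int_assoc)
        have "smooth_on (snd d ` (fst d \<inter> fst t \<inter> fst s) \<times> UNIV)
            (\<lambda>(x, w). let p = chart_inv d x in snd s p (triv_inv E t p w))"
          using smooth_transitions d t(1) s unfolding smooth_over_def by blast
        from smooth_on_compose[OF o1 o2 _ this smooth_on_Pair[OF o1
              smooth_on_bounded_linear[OF bounded_linear_ident] smooth_on_const]]
        show "smooth_on (snd d ` (fst d \<inter> ?V))
            ((\<lambda>q. snd s q (triv_inv E t q (snd t p u))) \<circ> chart_inv d)"
          by (auto simp: Let_def o_def)
      qed
      moreover have "smooth_map_on \<A> ?V (\<lambda>q. b (snd c q))"
        using smooth_map_on_compose_chart[OF c(1) b(1)]
        by (rule smooth_map_on_subset) (auto simp: U_def)
      ultimately have "smooth_map_on \<A> ?V (\<lambda>q. b (snd c q) *\<^sub>R snd s q (triv_inv E t q (snd t p u)))"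
        using V by (intro smooth_map_on_scaleR)
      then have "smooth_map_on \<A> ?V (\<lambda>q. snd s q (Z q))"
        by (rule smooth_map_on_cong[OF V, THEN iffD1, rotated])
          (simp add: Z_def linear_on_scale[OF lin] triv_inv_mem[OF t(1)])
      then show ?thesis using V True q by (intro exI[of _ ?V]) (auto simp: U_def)
    next
      case False
      let ?V = "fst s - K"
      have V: "open ?V" using triv_open[OF s] \<open>closed K\<close> by (rule open_Diff)
      have "K \<subseteq> U" using r(2) chart_inv_chart[OF c(1)] by (force simp: K_def U_def)
      have "snd s q 0 = 0" if "q \<in> fst s" for q
        using linear_on_scale[OF lin[OF that], of 0 0] subspace_0[OF subspace_fibre] by simp
      then have "smooth_map_on \<A> ?V (\<lambda>q. snd s q (Z q))"
        by (intro smooth_map_on_cong[OF V, THEN iffD1, OF _ smooth_map_on_const[of _ 0]])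
          (auto simp: Z_def outside)
      then show ?thesis using V False q \<open>K \<subseteq> U\<close> by (intro exI[of _ ?V]) auto
    qed
  qed
  moreover have "Z q \<in> fibre E q" for q
    using triv_inv_mem[OF t(1)] subspace_fibre[of q]
    by (auto simp: Z_def U_def subspace_scale subspace_0)
  moreover have "Z p = u"
    using b(2) c t assms by (simp add: Z_def U_def triv_inv_triv)
  ultimately show ?thesis by (intro that[of Z]) (auto simp: Sec_def)
qed

end

section \<open>Bundle maps\<close>

lemma bundle_map_linear: "bundle_map \<A> E F \<Phi> \<Longrightarrow> linear_on (fibre E p) (\<Phi> p)"
  by (simp add: bundle_map_def)

lemma bundle_map_mem: "bundle_map \<A> E F \<Phi> \<Longrightarrow> v \<in> fibre E p \<Longrightarrow> \<Phi> p v \<in> fibre F p"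
  unfolding bundle_map_def by blast

text \<open>
  Around a point, a trivialisation \<open>s\<close> of the source is inserted: in coordinates, \<open>app \<Phi> X\<close> is the
  smooth local expression of \<open>\<Phi>\<close> composed with \<open>x \<mapsto> (x, X\<^sub>s x)\<close>, where \<open>X\<^sub>s\<close> represents \<open>X\<close> in \<open>s\<close>.
\<close>

lemma bundle_map_app_Sec:
  assumes "vector_bundle \<A> E" "vector_bundle \<A> F" "bundle_map \<A> E F \<Phi>" "X \<in> Sec \<A> E"
  shows "app \<Phi> X \<in> Sec \<A> F"
proof -
  interpret E: vector_bundle \<A> E by fact
  interpret F: vector_bundle \<A> F by fact
  have "smooth_map_on \<A> (fst t) (\<lambda>p. snd t p (app \<Phi> X p))" if t: "t \<in> trivs F" for t
  proof (rule E.smooth_map_onI_local)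
    fix p assume p: "p \<in> fst t"
    obtain s where s: "s \<in> trivs E" "p \<in> fst s" by (rule E.triv_at)
    let ?V = "fst s \<inter> fst t"
    have V: "open ?V" using E.triv_open[OF s(1)] F.triv_open[OF t] by blast
    have "smooth_map_on \<A> ?V (\<lambda>p. snd t p (app \<Phi> X p))"
      unfolding smooth_map_on_def
    proof (intro ballI)
      fix c assume c: "c \<in> \<A>"
      let ?W = "snd c ` (fst c \<inter> fst s \<inter> fst t)"
      have W: "open ?W" using E.open_chart_image[OF c V] by (simp add: Int_assoc)
      have "smooth_on ?W ((\<lambda>p. snd s p (X p)) \<circ> chart_inv c)"
        using E.Sec_smooth[OF assms(4) s(1)] c unfolding smooth_map_on_def
        by (auto intro: smooth_on_subset)
      from smooth_on_Pair[OF W smooth_on_bounded_linear[OF bounded_linear_ident] this]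
      have G: "smooth_on ?W (\<lambda>x. (x, snd s (chart_inv c x) (X (chart_inv c x))))"
        by (simp add: o_def)
      have "smooth_on (?W \<times> UNIV) (\<lambda>(x, w). let p = chart_inv c x in snd t p (\<Phi> p (triv_inv E s p w)))"
        using assms(3) c s(1) t unfolding bundle_map_def smooth_over_def by blast
      from smooth_on_compose[OF W open_Times[OF W open_UNIV] _ this G]
      have "smooth_on ?W (\<lambda>x. snd t (chart_inv c x) (\<Phi> (chart_inv c x)
          (triv_inv E s (chart_inv c x) (snd s (chart_inv c x) (X (chart_inv c x))))))"
        by (auto simp: Let_def)
      then have "smooth_on ?W ((\<lambda>p. snd t p (app \<Phi> X p)) \<circ> chart_inv c)"
        by (rule smooth_on_cong[OF W, THEN iffD1, rotated])
          (auto simp: app_def E.chart_inv_chart[OF c] E.triv_inv_triv[OF s(1)] Sec_fibre[OF assms(4)])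
      then show "smooth_on (snd c ` (fst c \<inter> ?V)) ((\<lambda>p. snd t p (app \<Phi> X p)) \<circ> chart_inv c)"
        by (simp add: Int_assoc)
    qed
    then show "\<exists>V. open V \<and> p \<in> V \<and> smooth_map_on \<A> V (\<lambda>p. snd t p (app \<Phi> X p))"
      using V p s by blast
  qed
  then show ?thesis
    using bundle_map_mem[OF assms(3) Sec_fibre[OF assms(4)]] by (simp add: Sec_def app_def)
qed

text \<open>
  Smoothness of the composite is tested in trivialisations of \<open>E\<close> and \<open>G\<close> alone; around each point a
  trivialisation \<open>r\<close> of \<open>F\<close> splits the coordinate expression into those of \<open>\<Phi>\<close> and \<open>\<Psi>\<close>.
\<close>

lemma bundle_map_compose:
  fixes \<A> :: "('m::{t2_space,second_countable_topology}, 'e::finite_dim_inner) chart set"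
    and E :: "('m, 'a::real_vector, 'f::finite_dim_inner) vbundle"
    and F :: "('m, 'b::real_vector, 'g::finite_dim_inner) vbundle"
    and G :: "('m, 'c::real_vector, 'h::real_normed_vector) vbundle"
  assumes "vector_bundle \<A> E" "vector_bundle \<A> F" "\<And>t. t \<in> trivs G \<Longrightarrow> open (fst t)"
    and "bundle_map \<A> E F \<Phi>" "bundle_map \<A> F G \<Psi>"
  shows "bundle_map \<A> E G (\<lambda>p v. \<Psi> p (\<Phi> p v))"
proof -
  interpret E: vector_bundle \<A> E by fact
  interpret F: vector_bundle \<A> F by fact
  have "smooth_over \<A> E G (\<lambda>p v. \<Psi> p (\<Phi> p v))"
    unfolding smooth_over_def
  proof (intro ballI smooth_on_local)
    fix c s t and z :: "'e \<times> 'f"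
    assume c: "c \<in> \<A>" and s: "s \<in> trivs E" and t: "t \<in> trivs G"
      and "z \<in> (snd c ` (fst c \<inter> fst s \<inter> fst t)) \<times> UNIV"
    then obtain p w where p: "p \<in> fst c" "p \<in> fst s" "p \<in> fst t" "z = (snd c p, w)" by auto
    obtain r where r: "r \<in> trivs F" "p \<in> fst r" by (rule F.triv_at)
    let ?W = "snd c ` (fst c \<inter> (fst s \<inter> fst t \<inter> fst r))"
    have W: "open ?W"
      using E.triv_open[OF s] F.triv_open[OF r(1)] assms(3)[OF t]
      by (intro E.open_chart_image[OF c] open_Int)
    have WU: "open (?W \<times> UNIV)" using open_Times[OF W open_UNIV] .
    have "smooth_on ((snd c ` (fst c \<inter> fst s \<inter> fst r)) \<times> UNIV)
        (\<lambda>(x, w). let p = chart_inv c x in snd r p (\<Phi> p (triv_inv E s p w)))"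
      using assms(4) c s r(1) unfolding bundle_map_def smooth_over_def by blast
    then have "smooth_on (?W \<times> UNIV)
        (\<lambda>(x, w). let p = chart_inv c x in snd r p (\<Phi> p (triv_inv E s p w)))"
      by (rule smooth_on_subset) auto
    from smooth_on_Pair[OF WU smooth_on_bounded_linear[OF bounded_linear_fst] this]
    have 1: "smooth_on (?W \<times> UNIV)
        (\<lambda>z. (fst z, snd r (chart_inv c (fst z)) (\<Phi> (chart_inv c (fst z)) (triv_inv E s (chart_inv c (fst z)) (snd z)))))"
      by (simp add: case_prod_beta Let_def)
    have "smooth_on ((snd c ` (fst c \<inter> fst r \<inter> fst t)) \<times> UNIV)
        (\<lambda>(x, w). let p = chart_inv c x in snd t p (\<Psi> p (triv_inv F r p w)))"
      using assms(5) c r(1) t unfolding bundle_map_def smooth_over_def by blast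
    then have 2: "smooth_on (?W \<times> UNIV)
        (\<lambda>(x, w). let p = chart_inv c x in snd t p (\<Psi> p (triv_inv F r p w)))"
      by (rule smooth_on_subset) auto
    from smooth_on_compose[OF WU WU _ 2 1]
    have "smooth_on (?W \<times> UNIV) (\<lambda>z. snd t (chart_inv c (fst z)) (\<Psi> (chart_inv c (fst z))
        (triv_inv F r (chart_inv c (fst z)) (snd r (chart_inv c (fst z)) (\<Phi> (chart_inv c (fst z))
          (triv_inv E s (chart_inv c (fst z)) (snd z)))))))"
      by (auto simp: Let_def image_subset_iff)
    then have "smooth_on (?W \<times> UNIV)
        (\<lambda>(x, w). let p = chart_inv c x in snd t p (\<Psi> p (\<Phi> p (triv_inv E s p w))))"
      by (rule smooth_on_cong[OF WU, THEN iffD1, rotated])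
        (auto simp: Let_def E.chart_inv_chart[OF c] F.triv_inv_triv[OF r(1)]
          bundle_map_mem[OF assms(4)] E.triv_inv_mem[OF s])
    then show "\<exists>U. open U \<and> z \<in> U \<and> smooth_on U
        (\<lambda>(x, w). let p = chart_inv c x in snd t p (\<Psi> p (\<Phi> p (triv_inv E s p w))))"
      using WU p r by blast
  qed
  moreover have "linear_on (fibre E p) (\<lambda>v. \<Psi> p (\<Phi> p v))" for p
    using bundle_map_linear[OF assms(4), of p] bundle_map_linear[OF assms(5), of p]
      bundle_map_mem[OF assms(4), of _ p] by (simp add: linear_on_def)
  ultimately show ?thesis
    using bundle_map_mem[OF assms(4)] bundle_map_mem[OF assms(5)] by (auto simp: bundle_map_def)
qed

section \<open>Courant algebroids\<close>

context courant_algebroid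
begin

lemma metric_sym: "u \<in> fibre A p \<Longrightarrow> v \<in> fibre A p \<Longrightarrow> g p u v = g p v u"
  using metric by (simp add: bundle_metric_def)

lemma metric_linear: "u \<in> fibre A p \<Longrightarrow> linear_on (fibre A p) (g p u)"
  using metric by (simp add: bundle_metric_def)

lemma metric_add_right:
  "u \<in> fibre A p \<Longrightarrow> v \<in> fibre A p \<Longrightarrow> w \<in> fibre A p \<Longrightarrow> g p u (v + w) = g p u v + g p u w"
  by (rule linear_on_add[OF metric_linear])

lemma metric_scale_right:
  "u \<in> fibre A p \<Longrightarrow> v \<in> fibre A p \<Longrightarrow> g p u (r *\<^sub>R v) = r * g p u v"
  using linear_on_scale[OF metric_linear] by simp

lemma metric_add_left:
  assumes "u \<in> fibre A p" "v \<in> fibre A p" "w \<in> fibre A p"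
  shows "g p (u + v) w = g p u w + g p v w"
  using assms metric_sym[of "u + v" p w] metric_sym[of u p w] metric_sym[of v p w]
    subspace_add[OF subspace_fibre, of u p v] by (simp add: metric_add_right)

lemma metric_scale_left:
  assumes "u \<in> fibre A p" "v \<in> fibre A p"
  shows "g p (r *\<^sub>R u) v = r * g p u v"
  using assms metric_sym[of "r *\<^sub>R u" p v] metric_sym[of u p v]
    subspace_scale[OF subspace_fibre, of u p r] by (simp add: metric_scale_right)

text \<open>
  The axioms of a Courant algebroid speak of global sections, nondegeneracy of vectors in a fibre.
  The two match because every vector is the value of a global section.
\<close>

lemma eq_0_if_orthogonal_to_sections:
  assumes v: "v \<in> fibre A p" and "\<And>Z. Z \<in> Sec \<A> A \<Longrightarrow> g p v (Z p) = 0"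
  shows "v = 0"
proof -
  have "g p v u = 0" if "u \<in> fibre A p" for u
    using section_through[OF that] assms(2) by metis
  with v metric show ?thesis by (simp add: bundle_metric_def)
qed

lemma metric_smooth:
  assumes "X \<in> Sec \<A> A" "Y \<in> Sec \<A> A"
  shows "smooth_map_on \<A> UNIV (\<lambda>p. g p (X p) (Y p))"
proof (rule smooth_map_onI_local)
  fix p :: 'm
  obtain t where t: "t \<in> trivs A" "p \<in> fst t" by (rule triv_at)
  have "smooth_map_on \<A> (fst t) (\<lambda>p. g p (X p) (Y p))"
    unfolding smooth_map_on_def
  proof (intro ballI)
    fix c assume c: "c \<in> \<A>"
    let ?W = "snd c ` (fst c \<inter> fst t)"
    have W: "open ?W" by (rule open_chart_image[OF c triv_open[OF t(1)]])
    have X: "smooth_on ?W (\<lambda>x. snd t (chart_inv c x) (X (chart_inv c x)))"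
      and Y: "smooth_on ?W (\<lambda>x. snd t (chart_inv c x) (Y (chart_inv c x)))"
      using Sec_smooth[OF assms(1) t(1)] Sec_smooth[OF assms(2) t(1)] c
      by (auto simp: smooth_map_on_def o_def)
    have "smooth_on (?W \<times> UNIV) (\<lambda>(x, w, z). let p = chart_inv c x in g p (triv_inv A t p w) (triv_inv A t p z))"
      using metric c t(1) unfolding bundle_metric_def by blast
    from smooth_on_compose[OF W open_Times[OF W open_UNIV] _ this
        smooth_on_Pair[OF W smooth_on_bounded_linear[OF bounded_linear_ident] smooth_on_Pair[OF W X Y]]]
    have "smooth_on ?W (\<lambda>x. g (chart_inv c x)
        (triv_inv A t (chart_inv c x) (snd t (chart_inv c x) (X (chart_inv c x))))
        (triv_inv A t (chart_inv c x) (snd t (chart_inv c x) (Y (chart_inv c x)))))"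
      by (auto simp: Let_def)
    then show "smooth_on ?W ((\<lambda>p. g p (X p) (Y p)) \<circ> chart_inv c)"
      by (rule smooth_on_cong[OF W, THEN iffD1, rotated])
        (auto simp: chart_inv_chart[OF c] triv_inv_triv[OF t(1)] Sec_fibre[OF assms(1)] Sec_fibre[OF assms(2)])
  qed
  then show "\<exists>V. open V \<and> p \<in> V \<and> smooth_map_on \<A> V (\<lambda>p. g p (X p) (Y p))"
    using t triv_open by blast
qed

abbreviation anchor_deriv :: "('m \<Rightarrow> 'a) \<Rightarrow> ('m \<Rightarrow> real) \<Rightarrow> 'm \<Rightarrow> real" where
  "anchor_deriv X f \<equiv> deriv_along \<A> (\<lambda>p. \<rho> p (X p)) f"

lemma circ_Sec: "X \<in> Sec \<A> A \<Longrightarrow> Y \<in> Sec \<A> A \<Longrightarrow> circ X Y \<in> Sec \<A> A"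
  using leibniz by (simp add: leibniz_product_def bilinear_product_def closed_under_def)

lemma circ_fibre: "X \<in> Sec \<A> A \<Longrightarrow> Y \<in> Sec \<A> A \<Longrightarrow> circ X Y p \<in> fibre A p"
  by (intro Sec_fibre[where \<A> = \<A>] circ_Sec)

lemma circ_add:
  assumes "X \<in> Sec \<A> A" "Y \<in> Sec \<A> A" "Z \<in> Sec \<A> A"
  shows "circ (\<lambda>p. X p + Y p) Z = (\<lambda>p. circ X Z p + circ Y Z p)"
    and "circ Z (\<lambda>p. X p + Y p) = (\<lambda>p. circ Z X p + circ Z Y p)"
  using leibniz assms by (simp_all add: leibniz_product_def bilinear_product_def)

lemma circ_cmult:
  assumes "X \<in> Sec \<A> A" "Y \<in> Sec \<A> A"
  shows "circ (\<lambda>p. r *\<^sub>R X p) Y = (\<lambda>p. r *\<^sub>R circ X Y p)"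
    and "circ X (\<lambda>p. r *\<^sub>R Y p) = (\<lambda>p. r *\<^sub>R circ X Y p)"
  using leibniz assms by (simp_all add: leibniz_product_def bilinear_product_def)

lemma circ_diff:
  assumes "X \<in> Sec \<A> A" "Y \<in> Sec \<A> A" "Z \<in> Sec \<A> A"
  shows "circ (\<lambda>p. X p - Y p) Z = (\<lambda>p. circ X Z p - circ Y Z p)"
    and "circ Z (\<lambda>p. X p - Y p) = (\<lambda>p. circ Z X p - circ Z Y p)"
  using circ_add[OF assms(1) Sec_cmult[OF assms(2), of "-1"] assms(3)]
    circ_cmult(1)[OF assms(2,3), of "-1"] circ_cmult(2)[OF assms(3,2), of "-1"]
  by (simp_all del: scaleR_minus_left add: scaleR_minus1_left)

lemma circ_leibniz:
  assumes "X \<in> Sec \<A> A" "Y \<in> Sec \<A> A" "Z \<in> Sec \<A> A"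
  shows "circ (circ X Y) Z p = circ X (circ Y Z) p - circ Y (circ X Z) p"
  using leibniz assms by (simp add: leibniz_product_def)

text \<open>
  This polarises the left-hand side common to both compatibility axioms. The next two lemmas
  polarise the axioms themselves.
\<close>

lemma anchor_deriv_metric_sum:
  assumes "X \<in> Sec \<A> A" "Y \<in> Sec \<A> A" "Z \<in> Sec \<A> A"
  shows "anchor_deriv X (\<lambda>p. g p (Y p + Z p) (Y p + Z p)) p =
    anchor_deriv X (\<lambda>p. g p (Y p) (Y p)) p + 2 * anchor_deriv X (\<lambda>p. g p (Y p) (Z p)) p
      + anchor_deriv X (\<lambda>p. g p (Z p) (Z p)) p"
proof -
  have eq: "(\<lambda>p. g p (Y p + Z p) (Y p + Z p)) =
      (\<lambda>p. g p (Y p) (Y p) + (g p (Y p) (Z p) + g p (Y p) (Z p)) + g p (Z p) (Z p))"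
    using metric_sym Sec_fibre[OF assms(2)] Sec_fibre[OF assms(3)] subspace_add[OF subspace_fibre]
    by (intro ext) (simp add: metric_add_left metric_add_right)
  note s = metric_smooth[OF assms(2) assms(2)] metric_smooth[OF assms(2) assms(3)]
    metric_smooth[OF assms(3) assms(3)]
  show ?thesis
    unfolding eq
    by (simp only: deriv_along_add smooth_map_on_add s open_UNIV mult_2)
qed

lemma anchor_deriv_metric_circ_sym:
  assumes "X \<in> Sec \<A> A" "Y \<in> Sec \<A> A" "Z \<in> Sec \<A> A"
  shows "anchor_deriv X (\<lambda>p. g p (Y p) (Z p)) p = g p (X p) (circ Y Z p + circ Z Y p)"
proof -
  have f: "X p \<in> fibre A p" "circ Y Y p \<in> fibre A p" "circ Y Z p \<in> fibre A p"
    "circ Z Y p \<in> fibre A p" "circ Z Z p \<in> fibre A p"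
    using assms by (auto intro: circ_fibre Sec_fibre)
  show ?thesis
    using fun_cong[OF compat_right[OF assms(1) Sec_add[OF assms(2,3)]], of p]
      fun_cong[OF compat_right[OF assms(1,2)], of p] fun_cong[OF compat_right[OF assms(1,3)], of p]
      anchor_deriv_metric_sum[OF assms, of p] f subspace_add[OF subspace_fibre[of p]]
    by (simp add: circ_add assms Sec_add metric_add_right)
qed

lemma anchor_deriv_metric_circ:
  assumes "X \<in> Sec \<A> A" "Y \<in> Sec \<A> A" "Z \<in> Sec \<A> A"
  shows "anchor_deriv X (\<lambda>p. g p (Y p) (Z p)) p = g p (circ X Y p) (Z p) + g p (Y p) (circ X Z p)"
proof -
  have f: "Y p \<in> fibre A p" "Z p \<in> fibre A p" "circ X Y p \<in> fibre A p" "circ X Z p \<in> fibre A p"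
    using assms by (auto intro: circ_fibre Sec_fibre)
  show ?thesis
    using fun_cong[OF compat_left[OF assms(1) Sec_add[OF assms(2,3)]], of p]
      fun_cong[OF compat_left[OF assms(1,2)], of p] fun_cong[OF compat_left[OF assms(1,3)], of p]
      anchor_deriv_metric_sum[OF assms, of p] f subspace_add[OF subspace_fibre[of p]]
      metric_sym[OF f(1,4)]
    by (simp add: circ_add assms Sec_add metric_add_right metric_add_left)
qed

text \<open>
  The Leibniz rule for the anchor is not an axiom. It follows by differentiating
  \<open>\<langle>f Y, Z\<rangle> = f \<langle>Y, Z\<rangle>\<close> along \<open>X\<close>, once by invariance of the metric and once by the product rule:
  the two sides of the claim have the same product with every section \<open>Z\<close>.
\<close>

lemma circ_function_right:
  assumes X: "X \<in> Sec \<A> A" and Y: "Y \<in> Sec \<A> A" and f: "smooth_map_on \<A> UNIV f"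
  shows "circ X (\<lambda>p. f p *\<^sub>R Y p) p = f p *\<^sub>R circ X Y p + anchor_deriv X f p *\<^sub>R Y p"
proof -
  let ?V = "circ X (\<lambda>p. f p *\<^sub>R Y p) p + (- f p) *\<^sub>R circ X Y p + (- anchor_deriv X f p) *\<^sub>R Y p"
  have fY: "(\<lambda>p. f p *\<^sub>R Y p) \<in> Sec \<A> A" by (rule Sec_scaleR[OF f Y])
  have mem: "circ X (\<lambda>p. f p *\<^sub>R Y p) p \<in> fibre A p" "circ X Y p \<in> fibre A p" "Y p \<in> fibre A p"
    using X Y fY by (auto intro: circ_fibre Sec_fibre)
  note sub = subspace_add[OF subspace_fibre[of p]] subspace_scale[OF subspace_fibre[of p]]
  have "g p ?V (Z p) = 0" if Z: "Z \<in> Sec \<A> A" for Z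
  proof -
    have Zp: "Z p \<in> fibre A p" "circ X Z p \<in> fibre A p" using X Z by (auto intro: circ_fibre Sec_fibre)
    have "(\<lambda>p. g p (f p *\<^sub>R Y p) (Z p)) = (\<lambda>p. f p * g p (Y p) (Z p))"
      using Sec_fibre[OF Y] Sec_fibre[OF Z] by (simp add: metric_scale_left)
    then have "g p (circ X (\<lambda>p. f p *\<^sub>R Y p) p) (Z p) + g p (f p *\<^sub>R Y p) (circ X Z p) =
        f p * anchor_deriv X (\<lambda>p. g p (Y p) (Z p)) p + anchor_deriv X f p * g p (Y p) (Z p)"
      using anchor_deriv_metric_circ[OF X fY Z, of p] deriv_along_mult[OF f metric_smooth[OF Y Z]]
      by simp
    then show ?thesis
      using anchor_deriv_metric_circ[OF X Y Z, of p] mem Zp sub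
      by (simp add: metric_add_left metric_scale_left algebra_simps del: scaleR_minus_left)
  qed
  moreover have "?V \<in> fibre A p" by (intro sub mem)
  ultimately have "?V = 0" by (intro eq_0_if_orthogonal_to_sections)
  then show ?thesis by (simp add: algebra_simps)
qed

section \<open>Contracted products\<close>

lemma app_Sec: "bundle_map \<A> A A N \<Longrightarrow> X \<in> Sec \<A> A \<Longrightarrow> app N X \<in> Sec \<A> A"
  by (rule bundle_map_app_Sec[OF vector_bundle_axioms vector_bundle_axioms])

lemma contracted_Sec:
  assumes "bundle_map \<A> A A N" "X \<in> Sec \<A> A" "Y \<in> Sec \<A> A"
  shows "contracted circ N X Y \<in> Sec \<A> A"
  unfolding contracted_def using assms by (intro Sec_add Sec_diff circ_Sec app_Sec)

lemma app_add:
  assumes "bundle_map \<A> A A N" "X \<in> Sec \<A> A" "Y \<in> Sec \<A> A"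
  shows "app N (\<lambda>p. X p + Y p) = (\<lambda>p. app N X p + app N Y p)"
  using linear_on_add[OF bundle_map_linear[OF assms(1)]] Sec_fibre[OF assms(2)] Sec_fibre[OF assms(3)]
  by (simp add: app_def)

lemma app_diff:
  assumes "bundle_map \<A> A A N" "X \<in> Sec \<A> A" "Y \<in> Sec \<A> A"
  shows "app N (\<lambda>p. X p - Y p) = (\<lambda>p. app N X p - app N Y p)"
  using linear_on_diff[OF bundle_map_linear[OF assms(1)] subspace_fibre]
    Sec_fibre[OF assms(2)] Sec_fibre[OF assms(3)]
  by (simp add: app_def)

lemma app_scaleR:
  assumes "bundle_map \<A> A A N" "X \<in> Sec \<A> A"
  shows "app N (\<lambda>p. f p *\<^sub>R X p) = (\<lambda>p. f p *\<^sub>R app N X p)"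
  using linear_on_scale[OF bundle_map_linear[OF assms(1)]] Sec_fibre[OF assms(2)]
  by (simp add: app_def)

lemma contracted_add:
  assumes "bundle_map \<A> A A N" "X \<in> Sec \<A> A" "Y \<in> Sec \<A> A" "Z \<in> Sec \<A> A"
  shows "contracted circ N (\<lambda>p. X p + Y p) Z = (\<lambda>p. contracted circ N X Z p + contracted circ N Y Z p)"
    and "contracted circ N Z (\<lambda>p. X p + Y p) = (\<lambda>p. contracted circ N Z X p + contracted circ N Z Y p)"
  using assms
  by (auto simp: contracted_def app_add circ_add app_Sec circ_Sec)

lemma contracted_cmult:
  assumes "bundle_map \<A> A A N" "X \<in> Sec \<A> A" "Y \<in> Sec \<A> A"
  shows "contracted circ N (\<lambda>p. r *\<^sub>R X p) Y = (\<lambda>p. r *\<^sub>R contracted circ N X Y p)"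
    and "contracted circ N X (\<lambda>p. r *\<^sub>R Y p) = (\<lambda>p. r *\<^sub>R contracted circ N X Y p)"
  using assms
  by (auto simp: contracted_def app_scaleR circ_cmult app_Sec circ_Sec algebra_simps)

text \<open>
  The terms in which \<open>f\<close> is differentiated along \<open>X\<close> itself, \<open>(\<rho>(X)f) N Y\<close> from \<open>X \<circ> N(f Y)\<close> and from
  \<open>N(X \<circ> f Y)\<close>, cancel. Only the derivative along \<open>N X\<close> remains, so the anchor of the contracted
  product is \<open>\<rho> \<circ> N\<close>.
\<close>

lemma contracted_function_right:
  assumes N: "bundle_map \<A> A A N" and X: "X \<in> Sec \<A> A" and Y: "Y \<in> Sec \<A> A"
    and f: "smooth_map_on \<A> UNIV f"
  shows "contracted circ N X (\<lambda>p. f p *\<^sub>R Y p) p =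
    f p *\<^sub>R contracted circ N X Y p + anchor_deriv (app N X) f p *\<^sub>R Y p"
proof -
  note S = app_Sec[OF N X] app_Sec[OF N Y]
  have "N p (circ X (\<lambda>p. f p *\<^sub>R Y p) p) =
      f p *\<^sub>R N p (circ X Y p) + anchor_deriv X f p *\<^sub>R N p (Y p)"
    using circ_fibre[OF X Y, of p] Sec_fibre[OF Y, of p] subspace_scale[OF subspace_fibre[of p]]
      linear_on_add[OF bundle_map_linear[OF N, of p]] linear_on_scale[OF bundle_map_linear[OF N, of p]]
    by (simp add: circ_function_right[OF X Y f])
  then show ?thesis
    by (simp add: contracted_def app_scaleR[OF N Y] circ_function_right[OF S(1) Y f]
        circ_function_right[OF X S(2) f] algebra_simps) (simp add: app_def)
qed

text \<open>
  The usual proof that a Nijenhuis tensor deforms a Leibniz product into a Leibniz product uses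
  \<open>N(U \<circ>\<^sub>N V) = N U \<circ> N V\<close> only when \<open>U\<close> and \<open>V\<close> are among \<open>X, Y, Z\<close> and their products, hence for
  elements of \<open>S\<close>, while \<open>N X\<close>, \<open>N Y\<close>, \<open>N Z\<close> may leave \<open>S\<close>. After these substitutions
  everything cancels by the Leibniz identity of \<open>\<circ>\<close> for the triples \<open>(N X, N Y, Z)\<close>, \<open>(N X, Y, N Z)\<close>,
  \<open>(X, N Y, N Z)\<close> and, under \<open>N\<close>, \<open>(N X, Y, Z)\<close>, \<open>(X, N Y, Z)\<close>, \<open>(X, Y, N Z)\<close>, and, under \<open>N\<^sup>2\<close>,
  \<open>(X, Y, Z)\<close>.
\<close>

lemma contracted_leibniz:
  assumes N: "bundle_map \<A> A A N" and S: "S \<subseteq> Sec \<A> A" "closed_under S circ"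
    and torsion: "\<And>X Y. X \<in> S \<Longrightarrow> Y \<in> S \<Longrightarrow> torsion circ N X Y = (\<lambda>p. 0)"
    and X: "X \<in> S" and Y: "Y \<in> S" and Z: "Z \<in> S"
  shows "contracted circ N (contracted circ N X Y) Z p =
    contracted circ N X (contracted circ N Y Z) p - contracted circ N Y (contracted circ N X Z) p"
proof -
  note XYZ = subsetD[OF S(1) X] subsetD[OF S(1) Y] subsetD[OF S(1) Z]
  note nXYZ = XYZ[THEN app_Sec[OF N]]
  note mem = XYZ nXYZ circ_Sec app_Sec[OF N]
  have cS: "circ U V \<in> S" if "U \<in> S" "V \<in> S" for U V
    using S(2) that by (simp add: closed_under_def)
  have nC: "app N (contracted circ N U V) = circ (app N U) (app N V)" if "U \<in> S" "V \<in> S" for U V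
    using fun_cong[OF torsion[OF that]] by (auto simp: torsion_def fun_eq_iff)
  have CL: "circ (contracted circ N U V) W =
      (\<lambda>p. circ (circ (app N U) V) W p + circ (circ U (app N V)) W p - circ (app N (circ U V)) W p)"
    if "U \<in> Sec \<A> A" "V \<in> Sec \<A> A" "W \<in> Sec \<A> A" for U V W
    using that by (simp add: contracted_def circ_add circ_diff mem Sec_add Sec_diff)
  have CR: "circ W (contracted circ N U V) =
      (\<lambda>p. circ W (circ (app N U) V) p + circ W (circ U (app N V)) p - circ W (app N (circ U V)) p)"
    if "U \<in> Sec \<A> A" "V \<in> Sec \<A> A" "W \<in> Sec \<A> A" for U V W
    using that by (simp add: contracted_def circ_add circ_diff mem Sec_add Sec_diff)
  have T: "circ (app N U) (app N V) p =
      app N (circ (app N U) V) p + app N (circ U (app N V)) p - app N (app N (circ U V)) p"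
    if "U \<in> S" "V \<in> S" for U V
  proof -
    have "U \<in> Sec \<A> A" "V \<in> Sec \<A> A" using that S(1) by auto
    then show ?thesis
      unfolding nC[OF that, symmetric]
      by (simp add: contracted_def app_add[OF N] app_diff[OF N] mem Sec_add Sec_diff)
  qed
  have LB: "circ (circ U V) W = (\<lambda>p. circ U (circ V W) p - circ V (circ U W) p)"
    if "U \<in> Sec \<A> A" "V \<in> Sec \<A> A" "W \<in> Sec \<A> A" for U V W
    using circ_leibniz[OF that] by (intro ext)
  have 1: "contracted circ N (contracted circ N X Y) Z p =
      circ (circ (app N X) (app N Y)) Z p + circ (contracted circ N X Y) (app N Z) p
        - app N (circ (contracted circ N X Y) Z) p"
    by (simp add: contracted_def[of _ _ "contracted circ N X Y"] nC X Y)
  have 2: "contracted circ N U (contracted circ N V Z) p =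
      circ (app N U) (contracted circ N V Z) p + circ U (circ (app N V) (app N Z)) p
        - app N (circ U (contracted circ N V Z)) p" if "V \<in> S" for U V
    by (simp add: contracted_def[of _ _ _ "contracted circ N V Z"] nC that Z)
  show ?thesis
    unfolding 1 2[OF X] 2[OF Y]
    by (simp add: CL CR mem app_add[OF N] app_diff[OF N] Sec_add Sec_diff T cS X Y Z LB)
qed

section \<open>Dirac structures\<close>

text \<open>
  By compatibility, the product of \<open>X \<circ> X\<close> with a section \<open>Z\<close> is half the derivative along \<open>\<rho>(Z)\<close> of
  the zero function \<open>\<langle>X, X\<rangle>\<close>.
\<close>

lemma circ_self_eq_0:
  assumes "X \<in> Sec \<A> A" "\<And>p. g p (X p) (X p) = 0"
  shows "circ X X p = 0"
proof (rule eq_0_if_orthogonal_to_sections)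
  show mem: "circ X X p \<in> fibre A p" using assms by (intro circ_fibre)
  fix Z assume Z: "Z \<in> Sec \<A> A"
  have "g p (Z p) (circ X X p) = 0"
    using fun_cong[OF compat_right[OF Z assms(1)], of p] 
    by (simp add: assms(2) deriv_along_def tangent_map_def o_def)
  then show "g p (circ X X p) (Z p) = 0"
    using metric_sym[OF mem Sec_fibre[OF Z]] by simp
qed

text \<open>
  The term \<open>N(X \<circ> X)\<close> vanishes by the previous lemma. The product of the other two,
  \<open>N X \<circ> X + X \<circ> N X\<close>, with a section \<open>Z\<close> is the derivative along \<open>\<rho>(Z)\<close> of \<open>\<langle>N X, X\<rangle> = 0\<close>.
\<close>

lemma contracted_self_eq_0:
  assumes N: "bundle_map \<A> A A N" and X: "X \<in> Sec \<A> A"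
    and iso: "\<And>p. g p (X p) (X p) = 0" "\<And>p. g p (N p (X p)) (X p) = 0"
  shows "contracted circ N X X p = 0"
proof (rule eq_0_if_orthogonal_to_sections)
  show mem: "contracted circ N X X p \<in> fibre A p"
    using contracted_Sec[OF N X X] by (rule Sec_fibre)
  fix Z assume Z: "Z \<in> Sec \<A> A"
  have N0: "N p 0 = 0"
    using linear_on_scale[OF bundle_map_linear[OF N, of p], of 0 0] subspace_0[OF subspace_fibre] by simp
  have "contracted circ N X X p = circ (app N X) X p + circ X (app N X) p"
    using circ_self_eq_0[OF X iso(1)] N0 by (simp add: contracted_def app_def)
  moreover have "g p (Z p) (circ (app N X) X p + circ X (app N X) p) = 0"
    using anchor_deriv_metric_circ_sym[OF Z app_Sec[OF N X] X, of p]
    by (simp add: app_def iso(2) deriv_along_def tangent_map_def o_def)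
  ultimately show "g p (contracted circ N X X p) (Z p) = 0"
    using metric_sym[OF mem Sec_fibre[OF Z]] by simp
qed

text \<open>
  Both summands of \<open>\<langle>N u, u\<rangle> + \<langle>u, N\<^sup>* u\<rangle> = \<lambda> \<langle>u, u\<rangle>\<close> are equal.
\<close>

lemma paired_isotropic:
  assumes "paired A g N" "u \<in> fibre A p" "g p u u = 0"
  shows "g p (N p u) u = 0"
proof -
  obtain N' l where N': "is_adjoint A g N N'" "N p u + N' p u = l *\<^sub>R u"
    using assms by (auto simp: paired_def)
  then have adj: "N' p u \<in> fibre A p" "g p (N p u) u = g p u (N' p u)"
    using assms(2) by (auto simp: is_adjoint_def)
  have Nu: "N p u = l *\<^sub>R u + (- 1) *\<^sub>R N' p u" using N'(2) by (simp add: algebra_simps)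
  have mem: "N p u \<in> fibre A p"
    unfolding Nu using adj assms(2) by (intro subspace_add[OF subspace_fibre] subspace_scale[OF subspace_fibre])
  have "g p (N p u) u + g p u (N' p u) = g p u (N p u + N' p u)"
    using adj mem assms(2) by (simp add: metric_add_right metric_sym)
  also have "\<dots> = 0"
    using assms(2,3) by (simp add: N'(2) metric_scale_right)
  finally show ?thesis using adj(2) by simp
qed

lemma dirac_Sec_subset:
  assumes "dirac_structure \<A> A circ g L"
  shows "Sec \<A> L \<subseteq> Sec \<A> A"
proof
  fix X assume "X \<in> Sec \<A> L"
  then show "X \<in> Sec \<A> A"
    using bundle_map_app_Sec[of \<A> L A "\<lambda>p v. v" X] assms vector_bundle_axioms
    by (simp add: dirac_structure_def subbundle_def app_def)
qed

text \<open>
  Polarisation of \<open>X \<circ>\<^sub>N X = 0\<close>, which holds for every section of an isotropic subbundle when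
  \<open>N\<close> is paired.
\<close>

lemma contracted_skew_on_dirac:
  assumes L: "dirac_structure \<A> A circ g L" and N: "bundle_map \<A> A A N" "paired A g N"
  shows "skew_product (Sec \<A> L) (contracted circ N)"
proof -
  interpret L: vector_bundle \<A> L using L by (simp add: dirac_structure_def subbundle_def)
  have sq: "contracted circ N X X p = 0" if X: "X \<in> Sec \<A> L" for X p
  proof (rule contracted_self_eq_0[OF N(1)])
    show XA: "X \<in> Sec \<A> A" using X dirac_Sec_subset[OF L] by blast
    show iso: "g q (X q) (X q) = 0" for q
      using L Sec_fibre[OF X, of q]
      by (simp add: dirac_structure_def maximal_isotropic_def isotropic_def)
    show "g q (N q (X q)) (X q) = 0" for q
      by (rule paired_isotropic[OF N(2) Sec_fibre[OF XA] iso])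
  qed
  have "contracted circ N X Y p = - contracted circ N Y X p" if X: "X \<in> Sec \<A> L" and Y: "Y \<in> Sec \<A> L" for X Y p
  proof -
    have XY: "X \<in> Sec \<A> A" "Y \<in> Sec \<A> A" using X Y dirac_Sec_subset[OF L] by blast+
    show ?thesis
      using sq[OF L.Sec_add[OF X Y], of p] sq[OF X, of p] sq[OF Y, of p]
      by (simp add: contracted_add[OF N(1)] XY Sec_add eq_neg_iff_add_eq_0 add.commute)
  qed
  then show ?thesis unfolding skew_product_def by (intro ballI ext)
qed

text \<open>
  Skew-symmetry turns the Leibniz identity of \<open>\<circ>\<^sub>N\<close> into the Jacobi identity.
\<close>

lemma dirac_nijenhuis_lie_algebroid:
  assumes DN: "dirac_nijenhuis \<A> A circ g L N"
  shows "lie_algebroid \<A> L (contracted circ N) (\<lambda>p v. \<rho> p (N p v))"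
proof -
  have L: "dirac_structure \<A> A circ g L" and N: "bundle_map \<A> A A N"
    and closed: "closed_under (Sec \<A> L) (contracted circ N)"
    and skew: "skew_product (Sec \<A> L) (contracted circ N)"
    and torsion: "\<And>X Y. X \<in> Sec \<A> L \<Longrightarrow> Y \<in> Sec \<A> L \<Longrightarrow> torsion circ N X Y = (\<lambda>p. 0)"
    using DN by (auto simp: dirac_nijenhuis_def)
  interpret L: vector_bundle \<A> L using L by (simp add: dirac_structure_def subbundle_def)
  have incl: "bundle_map \<A> L A (\<lambda>p v. v)" and circL: "closed_under (Sec \<A> L) circ"
    using L by (auto simp: dirac_structure_def subbundle_def)
  note sub = subsetD[OF dirac_Sec_subset[OF L]]
  show ?thesis
  proof
    show "bilinear_product (Sec \<A> L) (contracted circ N)"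
      using closed
      by (simp add: bilinear_product_def contracted_add[OF N] contracted_cmult[OF N] sub)
    show "skew_product (Sec \<A> L) (contracted circ N)" by fact
    have "bundle_map \<A> L A (\<lambda>p v. N p v)"
      using bundle_map_compose[OF L.vector_bundle_axioms vector_bundle_axioms triv_open incl N] .
    then show "bundle_map \<A> L (tangent_bundle \<A>) (\<lambda>p v. \<rho> p (N p v))"
      using charts
      by (intro bundle_map_compose[OF L.vector_bundle_axioms vector_bundle_axioms _ _ anchor])
        (auto simp: tangent_bundle_def)
    fix X Y assume X: "X \<in> Sec \<A> L" and Y: "Y \<in> Sec \<A> L"
    {
      fix Z p assume Z: "Z \<in> Sec \<A> L"
      let ?C = "contracted circ N"
      have C: "?C U V \<in> Sec \<A> L" if "U \<in> Sec \<A> L" "V \<in> Sec \<A> L" for U V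
        using closed that by (simp add: closed_under_def)
      have sk: "?C U V = (\<lambda>p. - ?C V U p)" if "U \<in> Sec \<A> L" "V \<in> Sec \<A> L" for U V
        using skew that unfolding skew_product_def by blast
      have "?C Y (?C Z X) p = - ?C Y (?C X Z) p"
        unfolding sk[OF Z X]
        using fun_cong[OF contracted_cmult(2)[OF N sub[OF Y] sub[OF C[OF X Z]], of "-1"], of p]
        by simp
      moreover have "?C Z (?C X Y) p = - ?C (?C X Y) Z p"
        using sk[OF Z C[OF X Y]] by simp
      moreover have "?C (?C X Y) Z p = ?C X (?C Y Z) p - ?C Y (?C X Z) p"
        by (rule contracted_leibniz[OF N dirac_Sec_subset[OF L] circL torsion X Y Z])
      ultimately show "?C X (?C Y Z) p + ?C Y (?C Z X) p + ?C Z (?C X Y) p = 0" by simp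
    }
    fix f :: "'m \<Rightarrow> real" assume "smooth_map_on \<A> UNIV f"
    then show "contracted circ N X (\<lambda>p. f p *\<^sub>R Y p) = (\<lambda>p. f p *\<^sub>R contracted circ N X Y p
        + deriv_along \<A> (\<lambda>p. \<rho> p (N p (X p))) f p *\<^sub>R Y p)"
      using contracted_function_right[OF N sub[OF X] sub[OF Y]]
      by (intro ext) (simp add: app_def)
  qed
qed

end

theorem theorem6:
  fixes \<A> :: "('m::{t2_space,second_countable_topology}, 'e::finite_dim_inner) chart set"
    and A :: "('m, 'a::real_vector, 'f::finite_dim_inner) vbundle"
    and L :: "('m, 'a, 'l::finite_dim_inner) vbundle"
    and circ :: "('m \<Rightarrow> 'a) \<Rightarrow> ('m \<Rightarrow> 'a) \<Rightarrow> 'm \<Rightarrow> 'a"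
    and \<rho> :: "'m \<Rightarrow> 'a \<Rightarrow> 'e"
    and g :: "'m \<Rightarrow> 'a \<Rightarrow> 'a \<Rightarrow> real"
  assumes "courant_algebroid \<A> A circ \<rho> g"
    and "dirac_structure \<A> A circ g L"
  shows "(\<forall>N. bundle_map \<A> A A N \<and> paired A g N \<and> outer_nijenhuis \<A> L circ N \<longrightarrow>
            dirac_nijenhuis \<A> A circ g L N) \<and>
         (\<forall>N. dirac_nijenhuis \<A> A circ g L N \<longrightarrow>
            (\<exists>\<rho>'. lie_algebroid \<A> L (contracted circ N) \<rho>') \<and>
            (\<forall>X\<in>Sec \<A> L. \<forall>Y\<in>Sec \<A> L.
               app N (contracted circ N X Y) = circ (app N X) (app N Y)))"
proof -
  interpret courant_algebroid \<A> A circ \<rho> g by fact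
  show ?thesis
  proof (intro conjI allI impI ballI)
    fix N assume "bundle_map \<A> A A N \<and> paired A g N \<and> outer_nijenhuis \<A> L circ N"
    then show "dirac_nijenhuis \<A> A circ g L N"
      using assms(2) contracted_skew_on_dirac[OF assms(2)]
      by (simp add: dirac_nijenhuis_def outer_nijenhuis_def)
  next
    fix N assume "dirac_nijenhuis \<A> A circ g L N"
    then show "\<exists>\<rho>'. lie_algebroid \<A> L (contracted circ N) \<rho>'"
      using dirac_nijenhuis_lie_algebroid by blast
  next
    fix N X Y assume "dirac_nijenhuis \<A> A circ g L N" "X \<in> Sec \<A> L" "Y \<in> Sec \<A> L"
    then have "torsion circ N X Y = (\<lambda>p. 0)" by (simp add: dirac_nijenhuis_def)
    then show "app N (contracted circ N X Y) = circ (app N X) (app N Y)"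
      by (simp add: torsion_def fun_eq_iff)
  qed
qed

end
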